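(* Let $\mathcal{G}$ be a finite group acting on the observation space $\mathcal{X}$, and consider a $p$-value family $(p_i(X))_{1\le i\le m}$ such that $$\forall P\in\mathcal{P},\ \forall g\in\mathcal{G}:\qquad (p_{\mathcal{H}_0}(g'.X))_{g'\in\mathcal{G}}\ \sim\ (p_{\mathcal{H}_0}(g'.g.X))_{g'\in\mathcal{G}}\quad\text{(equality in distribution for }X\sim P),$$ where $p_{\mathcal{H}_0}(x)=(p_i(x))_{i\in\mathcal{H}_0(P)}$ for $x\in\mathcal{X}$. Consider a deterministic template $t_k(\lambda)$, $\lambda\in[0,1]$, $1\leq k\leq K$, and the associated reference families $\mathfrak{R}_\lambda$. Let $B\geq2$, let $g_1$ be the identity element of $\mathcal{G}$ and let $g_2,\dots,g_B$ be i.i.d. uniformly distributed on $\mathcal{G}$, independent of all the other variables. For $A\subset\mathbb{N}_m$ and $x\in\mathcal{X}$ let $$\Psi(x,A)=\min_{1\leq k\leq K\wedge|A|}\big\{t_k^{-1}\big(p_{(k:A)}(x)\big)\big\},$$ and for $\alpha\in(0,1)$ define $$\lambda(\alpha,A)=\max\Big\{\lambda\in[0,1]:\ B^{-1}\sum_{j=1}^B\mathbf{1}\{\Psi(g_j.X,A)<\lambda\}\leq\alpha\Big\}.$$ Then the (data-dependent) functional $\lambda(\cdot,\cdot)$ is a $\lambda$-calibration, and for every $\alpha\in(0,1)$, $\mathfrak{R}_{\lambda(\alpha,\mathbb{N}_m)}$ and $\mathfrak{R}_{\lambda(\alpha,\widehat{A})}$ both control the JER at level $\alpha$: for all $P\in\mathcal{P}$,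 $\mathrm{JER}(\mathfrak{R}_{\lambda(\alpha,\mathbb{N}_m)},P)\leq\alpha$ and $\mathrm{JER}(\mathfrak{R}_{\lambda(\alpha,\widehat{A})},P)\leq\alpha$, where $\widehat{A}$ is the output of the step-down algorithm run with $\lambda(\cdot,\cdot)$.
   Context: $X$ is an observation in $\mathcal{X}$ with distribution $P$ belonging to a statistical model $\mathcal{P}$; $\mathbb{N}_m=\{1,\dots,m\}$ indexes null hypotheses $H_{0,i}\subset\mathcal{P}$; $\mathcal{H}_0=\mathcal{H}_0(P)=\{i\in\mathbb{N}_m: P\in H_{0,i}\}$ and $m_0=m_0(P)=|\mathcal{H}_0(P)|$. For each $i$, $p_i(x)\in[0,1]$, $x\in\mathcal{X}$, gives a $p$-value $p_i(X)$ for $H_{0,i}$. For $A\subset\mathbb{N}_m$ and $1\le k\le|A|$, $p_{(k:A)}(x)$ is the $k$-th smallest value among $\{p_i(x), i\in A\}$. $g.x$ denotes the image of $x$ under $g\in\mathcal{G}$, and $g'.g.x=g'.(g.x)$. Minima over an empty index set equal $+\infty$; $a\wedge b=\min(a,b)$. All probabilities are taken over $X\sim P$ and over the random draw of $g_2,\dots,g_B$; "data-dependent" allows dependence on $X$ and on $g_2,\dots,g_B$. Template: a family of functions $t_k(\lambda)$, $\lambda\in[0,1]$, $1\leq k\leq K$, with $K\in\{1,\dots,m\}$ fixed, such that for all $k$, $t_k(0)=0$ and $t_k(\cdot)$ is non-decreasing and left-continuous on $[0,1]$. Generalized inverse: $t_k^{-1}(y)=\max\{x\in[0,1]: t_k(x)\leq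 y\}$. Reference family: for $\lambda\in[0,1]$ (possibly data-dependent), $\mathfrak{R}_\lambda=(R_1(X),\dots,R_K(X))$ with $R_k(X)=\{i\in\mathbb{N}_m: p_i(X)<t_k(\lambda)\}$. The joint family-wise error rate of a family $\mathfrak{R}=(R_1(X),\dots,R_K(X))$ is $$\mathrm{JER}(\mathfrak{R},P)=1-\mathbb{P}_{X\sim P}\big(\forall k\in\{1,\dots,K\}:\ |R_k(X)\cap\mathcal{H}_0(P)|\leq k-1\big).$$ $\lambda$-calibration: a (possibly data-dependent) functional $\lambda(\alpha,A)\in[0,1]$, $\alpha\in(0,1)$, $A\subset\mathbb{N}_m$, such that (i) for all $\alpha\in(0,1)$ and $A\subset A'\subset\mathbb{N}_m$, $\lambda(\alpha,A')\leq\lambda(\alpha,A)$; and (ii) for all $\alpha\in(0,1)$ and $P\in\mathcal{P}$, $$\mathbb{P}_{X\sim P}\Big(\min_{1\leq k\leq K\wedge m_0}\big\{t_k^{-1}\big(p_{(k:\mathcal{H}_0(P))}(X)\big)\big\}<\lambda(\alpha,\mathcal{H}_0(P))\Big)\leq\alpha.$$ Step-down algorithm (given $\alpha$, a template and a functional $\lambda(\cdot,\cdot)$): set $A^{(0)}=\mathbb{N}_m$; for $j=1,2,\dots$ set $\lambda_j=\lambda(\alpha,A^{(j-1)})$ and $A^{(j)}=\{i\in\mathbb{N}_m:\ p_i(X)\geq t_1(\lambda_j)\}$; stop at the first $j\geq1$ such that $A^{(j)}=A^{(j-1)}$ and return $\widehat{A}=A^{(j)}$. *)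

theory Defs
  imports "HOL-Probability.Probability" "HOL-Algebra.Group_Action"
begin

definition true_nulls :: "(nat \<Rightarrow> 'x measure set) \<Rightarrow> nat \<Rightarrow> 'x measure \<Rightarrow> nat set" where
  "true_nulls H m P = {i \<in> {1..m}. P \<in> H i}"

text \<open>The \<open>k\<close>-th smallest of the values \<open>q i\<close>, \<open>i \<in> A\<close>, counted with multiplicity,
  for finite \<open>A\<close> and \<open>1 \<le> k \<le> card A\<close>.\<close>

definition order_stat :: "(nat \<Rightarrow> real) \<Rightarrow> nat set \<Rightarrow> nat \<Rightarrow> real" where
  "order_stat q A k = sorted_list_of_multiset (image_mset q (mset_set A)) ! (k - 1)"

definition is_template :: "nat \<Rightarrow> (nat \<Rightarrow> real \<Rightarrow> real) \<Rightarrow> bool" where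
  "is_template K t \<longleftrightarrow> (\<forall>k\<in>{1..K}. t k 0 = 0 \<and> mono_on {0..1} (t k) \<and>
     (\<forall>x\<in>{0<..1}. continuous (at_left x) (t k)))"

text \<open>The operator \<^term>\<open>Greatest\<close> is used for the maximum of a possibly infinite set of reals.
  Here and in \<open>rand_lambda\<close> below the maximum is attained, by left-continuity.\<close>

definition gen_inverse :: "(real \<Rightarrow> real) \<Rightarrow> real \<Rightarrow> real" where
  "gen_inverse f y = (GREATEST x. x \<in> {0..1} \<and> f x \<le> y)"

text \<open>Extended real values, so that the minimum over an empty index set is \<open>\<infinity>\<close>.\<close>

definition Psi :: "(nat \<Rightarrow> 'x \<Rightarrow> real) \<Rightarrow> nat \<Rightarrow> (nat \<Rightarrow> real \<Rightarrow> real) \<Rightarrow> 'x \<Rightarrow> nat set \<Rightarrow> ereal" where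
  "Psi p K t x A =
     (INF k\<in>{1..min K (card A)}. ereal (gen_inverse (t k) (order_stat (\<lambda>i. p i x) A k)))"

text \<open>Everything random is a function on one measurable space \<open>W\<close>; \<open>Q P\<close> is the probability
  measure on \<open>W\<close> under which the observation \<open>X\<close> has distribution \<open>P\<close>. A data-dependent quantity
  is thus a function of \<open>\<omega> \<in> space W\<close>.\<close>

definition ref_family ::
  "nat \<Rightarrow> (nat \<Rightarrow> 'x \<Rightarrow> real) \<Rightarrow> (nat \<Rightarrow> real \<Rightarrow> real) \<Rightarrow> ('w \<Rightarrow> 'x) \<Rightarrow> ('w \<Rightarrow> real) \<Rightarrow> nat \<Rightarrow> 'w \<Rightarrow> nat set"
where
  "ref_family m p t X l k \<omega> = {i \<in> {1..m}. p i (X \<omega>) < t k (l \<omega>)}"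

definition JER :: "'w measure \<Rightarrow> nat set \<Rightarrow> nat \<Rightarrow> (nat \<Rightarrow> 'w \<Rightarrow> nat set) \<Rightarrow> real" where
  "JER QP N K R =
     1 - measure QP {\<omega> \<in> space QP. \<forall>k\<in>{1..K}. card (R k \<omega> \<inter> N) \<le> k - 1}"

text \<open>Measurability of \<open>lam \<alpha> A\<close> is required explicitly, because \<^term>\<open>measure\<close> is \<open>0\<close> on
  non-measurable sets and the last clause would otherwise hold vacuously for such functionals.\<close>

definition is_lambda_calibration ::
  "'w measure \<Rightarrow> ('x measure \<Rightarrow> 'w measure) \<Rightarrow> 'x measure set \<Rightarrow> (nat \<Rightarrow> 'x measure set) \<Rightarrow> nat \<Rightarrow>
   (nat \<Rightarrow> 'x \<Rightarrow> real) \<Rightarrow> nat \<Rightarrow> (nat \<Rightarrow> real \<Rightarrow> real) \<Rightarrow> ('w \<Rightarrow> 'x) \<Rightarrow>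
   (real \<Rightarrow> nat set \<Rightarrow> 'w \<Rightarrow> real) \<Rightarrow> bool"
where
  "is_lambda_calibration W Q \<P> H m p K t X lam \<longleftrightarrow>
     (\<forall>\<alpha>\<in>{0<..<1}. \<forall>A. A \<subseteq> {1..m} \<longrightarrow>
        lam \<alpha> A \<in> borel_measurable W \<and> (\<forall>\<omega>\<in>space W. lam \<alpha> A \<omega> \<in> {0..1})) \<and>
     (\<forall>\<alpha>\<in>{0<..<1}. \<forall>A A'. A \<subseteq> A' \<and> A' \<subseteq> {1..m} \<longrightarrow>
        (\<forall>\<omega>\<in>space W. lam \<alpha> A' \<omega> \<le> lam \<alpha> A \<omega>)) \<and>
     (\<forall>\<alpha>\<in>{0<..<1}. \<forall>P\<in>\<P>.
        measure (Q P) {\<omega> \<in> space (Q P).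
          Psi p K t (X \<omega>) (true_nulls H m P) < ereal (lam \<alpha> (true_nulls H m P) \<omega>)} \<le> \<alpha>)"

fun step_down_seq ::
  "nat \<Rightarrow> (nat \<Rightarrow> 'x \<Rightarrow> real) \<Rightarrow> (nat \<Rightarrow> real \<Rightarrow> real) \<Rightarrow> ('w \<Rightarrow> 'x) \<Rightarrow>
   (real \<Rightarrow> nat set \<Rightarrow> 'w \<Rightarrow> real) \<Rightarrow> real \<Rightarrow> 'w \<Rightarrow> nat \<Rightarrow> nat set"
where
  "step_down_seq m p t X lam \<alpha> \<omega> 0 = {1..m}"
| "step_down_seq m p t X lam \<alpha> \<omega> (Suc j) =
     {i \<in> {1..m}. p i (X \<omega>) \<ge> t 1 (lam \<alpha> (step_down_seq m p t X lam \<alpha> \<omega> j) \<omega>)}"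

text \<open>If \<open>lam \<alpha>\<close> is antitone, the sequence is decreasing, so that the \<open>LEAST\<close> exists.\<close>

definition step_down ::
  "nat \<Rightarrow> (nat \<Rightarrow> 'x \<Rightarrow> real) \<Rightarrow> (nat \<Rightarrow> real \<Rightarrow> real) \<Rightarrow> ('w \<Rightarrow> 'x) \<Rightarrow>
   (real \<Rightarrow> nat set \<Rightarrow> 'w \<Rightarrow> real) \<Rightarrow> real \<Rightarrow> 'w \<Rightarrow> nat set"
where
  "step_down m p t X lam \<alpha> \<omega> =
     (let A = step_down_seq m p t X lam \<alpha> \<omega> in A (LEAST j. j \<ge> 1 \<and> A j = A (j - 1)))"

definition rand_lambda ::
  "('g \<Rightarrow> 'x \<Rightarrow> 'x) \<Rightarrow> nat \<Rightarrow> (nat \<Rightarrow> 'w \<Rightarrow> 'g) \<Rightarrow> (nat \<Rightarrow> 'x \<Rightarrow> real) \<Rightarrow> nat \<Rightarrow> (nat \<Rightarrow> real \<Rightarrow> real) \<Rightarrow>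
   ('w \<Rightarrow> 'x) \<Rightarrow> real \<Rightarrow> nat set \<Rightarrow> 'w \<Rightarrow> real"
where
  "rand_lambda act B g p K t X \<alpha> A \<omega> =
     (GREATEST l. l \<in> {0..1} \<and>
        (\<Sum>j=1..B. of_bool (Psi p K t (act (g j \<omega>) (X \<omega>)) A < ereal l)) / real B \<le> \<alpha>)"

end

theory Submission
  imports Defs
begin

text \<open>
  Fix a distribution \<open>P\<close>, let \<open>N\<close> be its set of true nulls, and let \<open>S h x\<close> be the statistic
  \<open>Psi\<close> of the transformed observation \<open>h.x\<close> over \<open>N\<close>. Left-continuity of the template makes all
  maxima attained, so that for \<open>l\<close> in the unit interval \<open>Psi x A < l\<close> says exactly that for some
  \<open>k \<in> {1..K}\<close> at least \<open>k\<close> of the values \<open>p i x\<close>, \<open>i \<in> A\<close>, lie strictly below \<open>t k l\<close>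
  (\<open>Psi_less_iff\<close>). Consequently the JER of the reference family with parameter \<open>l\<close> is the
  probability that \<open>Psi (X) N < l\<close>, also for random \<open>l\<close> (\<open>JER_ref_family\<close>), and \<open>\<lambda>(\<alpha>, A)\<close> is
  antitone in \<open>A\<close>, as \<open>Psi\<close> is (\<open>Psi_less_antimono\<close>, \<open>crit_mono\<close>).

  The heart of the matter is the bound \<open>\<alpha>\<close> for the probability that \<open>Psi (X) N < \<lambda>(\<alpha>, N)\<close>. By
  independence it is the average, over the deterministic tuples \<open>u = (1, u 2, \<dots>, u B)\<close> of group
  elements, of the \<open>P\<close>-probabilities that \<open>S (u 1)\<close> is below the critical value computed from
  \<open>S (u 1), \<dots>, S (u B)\<close> (\<open>random_group_elements_law\<close>). Multiplying \<open>u\<close> on the right by \<open>inv (u i)\<close>, which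
  the invariance hypothesis permits, and exchanging the entries \<open>1\<close> and \<open>i\<close> is an involution of these
  tuples; it shows that the average does not change when the index \<open>1\<close> of the compared statistic is
  replaced by \<open>i\<close>. Now sum over \<open>i\<close>: by definition of the critical value, at most \<open>\<alpha> * B\<close> of the \<open>B\<close>
  statistics lie strictly below it, whatever \<open>x\<close> and \<open>u\<close> are (\<open>randomization_average_bound\<close>,
  \<open>randomization_level\<close>).

  Off the event \<open>Psi (X) N < \<lambda>(\<alpha>, N)\<close>, each set \<open>A\<close> of the step-down sequence contains \<open>N\<close>: if
  \<open>N \<subseteq> A\<close> then \<open>\<lambda>(\<alpha>, A) \<le> \<lambda>(\<alpha>, N) \<le> Psi (X) N\<close>, so no true null has a \<open>p\<close>-value below
  \<open>t 1 (\<lambda>(\<alpha>, A))\<close> (\<open>step_down_superset\<close>). Antitonicity then yields that the parameters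
  \<open>\<lambda>(\<alpha>, {1..m})\<close> and \<open>\<lambda>(\<alpha>, step_down)\<close> are both at most \<open>\<lambda>(\<alpha>, N)\<close> there, so the JER is
  bounded by \<open>\<alpha>\<close> in either case.
\<close>

section \<open>Maxima of left-closed initial segments of the unit interval\<close>

text \<open>This gives existence and the characterising equivalence for both maxima of the problem, the
  generalised inverse and \<open>\<lambda>(\<alpha>, A)\<close>.\<close>
lemma greatest_unit_interval:
  fixes R :: "real \<Rightarrow> bool"
  assumes zero: "R 0"
    and down: "\<And>x y. 0 \<le> x \<Longrightarrow> x \<le> y \<Longrightarrow> y \<le> 1 \<Longrightarrow> R y \<Longrightarrow> R x"
    and left: "\<And>x. 0 < x \<Longrightarrow> x \<le> 1 \<Longrightarrow> (\<And>y. 0 \<le> y \<Longrightarrow> y < x \<Longrightarrow> R y) \<Longrightarrow> R x"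
  defines "s \<equiv> (GREATEST x. x \<in> {0..1} \<and> R x)"
  shows "s \<in> {0..1}" "\<And>x. x \<in> {0..1} \<Longrightarrow> R x \<longleftrightarrow> x \<le> s"
proof -
  define S where "S = {x \<in> {0..1}. R x}"
  have bdd: "bdd_above S" by (rule bdd_aboveI[of _ 1]) (simp add: S_def)
  have ne: "0 \<in> S" using zero by (simp add: S_def)
  have "0 \<le> Sup S" by (rule cSup_upper[OF ne bdd])
  moreover have "Sup S \<le> 1" by (rule cSup_least) (use ne in blast, simp add: S_def)
  ultimately have sup01: "Sup S \<in> {0..1}" by simp
  \<comment> \<open>\<open>R\<close> holds below its supremum, hence at the supremum by left-closedness.\<close>
  have below: "R y" if y: "0 \<le> y" "y < Sup S" for y
  proof -
    obtain z where "z \<in> S" "y < z" using less_cSupD[of S y] y(2) ne by blast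
    then show ?thesis using down[of y z] y by (simp add: S_def)
  qed
  have R: "R (Sup S)"
  proof (cases "Sup S = 0")
    case True
    then show ?thesis using zero by simp
  next
    case False
    then show ?thesis using left[of "Sup S"] below sup01 by simp
  qed
  have le: "x \<le> Sup S" if "x \<in> {0..1}" "R x" for x
    by (rule cSup_upper[OF _ bdd]) (use that in \<open>simp add: S_def\<close>)
  have gr: "s = Sup S"
    unfolding s_def by (rule Greatest_equality) (use sup01 R le in auto)
  show "s \<in> {0..1}" using sup01 gr by simp
  show "R x \<longleftrightarrow> x \<le> s" if "x \<in> {0..1}" for x
    using down[of x s] R sup01 that le[of x] gr by auto
qed

lemma gen_inverse_props:
  assumes tpl: "is_template K t" and k: "k \<in> {1..K}" and y: "0 \<le> y"
  shows "gen_inverse (t k) y \<in> {0..1}"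
    and "l \<in> {0..1} \<Longrightarrow> t k l \<le> y \<longleftrightarrow> l \<le> gen_inverse (t k) y"
proof -
  have 0: "t k 0 \<le> y" using tpl k y by (simp add: is_template_def)
  have mono: "t k a \<le> t k b" if "0 \<le> a" "a \<le> b" "b \<le> 1" for a b
  proof -
    have "mono_on {0..1} (t k)" using tpl k by (auto simp: is_template_def)
    then show ?thesis using that by (intro mono_onD[of "{0..1}" "t k"]) auto
  qed
  have left: "t k x \<le> y" if x: "0 < x" "x \<le> 1" and le: "\<And>z. 0 \<le> z \<Longrightarrow> z < x \<Longrightarrow> t k z \<le> y" for x
  proof (rule tendsto_upperbound)
    have "continuous (at_left x) (t k)" using tpl k x by (auto simp: is_template_def)
    then show "(t k \<longlongrightarrow> t k x) (at_left x)" by (simp add: continuous_within)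
    show "\<forall>\<^sub>F z in at_left x. t k z \<le> y"
      using eventually_at_left_real[OF x(1)] by eventually_elim (use le in auto)
  qed simp
  have *: "\<And>a b. 0 \<le> a \<Longrightarrow> a \<le> b \<Longrightarrow> b \<le> 1 \<Longrightarrow> t k b \<le> y \<Longrightarrow> t k a \<le> y"
    using mono order_trans by blast
  note G = greatest_unit_interval[of "\<lambda>x. t k x \<le> y", OF 0 * left, folded gen_inverse_def]
  show "gen_inverse (t k) y \<in> {0..1}" by (rule G(1))
  show "l \<in> {0..1} \<Longrightarrow> t k l \<le> y \<longleftrightarrow> l \<le> gen_inverse (t k) y" by (rule G(2))
qed

section \<open>Critical values\<close>

text \<open>The critical value of \<open>B\<close> extended real statistics \<open>\<tau> 1, \<dots>, \<tau> B\<close>: the largest \<open>l\<close> in the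
  unit interval such that at most a proportion \<open>\<alpha>\<close> of the \<open>\<tau> j\<close> is strictly below \<open>l\<close>.
  With \<open>\<tau> j = Psi (g j.X) A\<close> this is \<open>\<lambda>(\<alpha>, A)\<close>. For nonnegative \<open>\<tau>\<close> and
  \<open>\<alpha>\<close> the maximum is attained: \<open>l = 0\<close> is admissible, and admissibility passes to limits from
  the left.\<close>
definition crit :: "nat \<Rightarrow> real \<Rightarrow> (nat \<Rightarrow> ereal) \<Rightarrow> real" where
  "crit B \<alpha> \<tau> =
     (GREATEST l. l \<in> {0..1} \<and> (\<Sum>j=1..B. of_bool (\<tau> j < ereal l)) / real B \<le> \<alpha>)"

lemma crit_props:
  assumes \<alpha>: "0 \<le> \<alpha>" and \<tau>: "\<And>j. j \<in> {1..B} \<Longrightarrow> 0 \<le> \<tau> j"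
  shows "crit B \<alpha> \<tau> \<in> {0..1}"
    and "l \<in> {0..1} \<Longrightarrow>
      (\<Sum>j=1..B. of_bool (\<tau> j < ereal l)) / real B \<le> \<alpha> \<longleftrightarrow> l \<le> crit B \<alpha> \<tau>"
proof -
  let ?R = "\<lambda>l. (\<Sum>j=1..B. of_bool (\<tau> j < ereal l)) / real B \<le> \<alpha>"
  have mono: "?R a" if "\<And>j. j \<in> {1..B} \<Longrightarrow> \<tau> j < ereal a \<Longrightarrow> \<tau> j < ereal b" "?R b" for a b
  proof -
    have "(\<Sum>j=1..B. of_bool (\<tau> j < ereal a)) \<le> (\<Sum>j=1..B. of_bool (\<tau> j < ereal b) :: real)"
      by (intro sum_mono) (use that(1) in auto)
    then have "(\<Sum>j=1..B. of_bool (\<tau> j < ereal a)) / real B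
        \<le> (\<Sum>j=1..B. of_bool (\<tau> j < ereal b)) / real B"
      by (rule divide_right_mono) simp
    then show ?thesis using that(2) by linarith
  qed
  have "(\<Sum>j=1..B. of_bool (\<tau> j < ereal 0)) = (0::real)"
    by (intro sum.neutral) (use \<tau> in \<open>auto simp: zero_ereal_def[symmetric] not_less\<close>)
  then have 0: "?R 0" using \<alpha> by simp
  have down: "?R a" if "0 \<le> a" "a \<le> b" "b \<le> 1" "?R b" for a b
    by (rule mono[OF _ that(4)]) (use that in \<open>auto elim: less_le_trans\<close>)
  \<comment> \<open>Only finitely many \<open>\<tau> j\<close> are below \<open>x\<close>, and they are all below each \<open>z < x\<close> close enough to
    \<open>x\<close>.\<close>
  have left: "?R x" if x: "0 < x" and le: "\<And>z. 0 \<le> z \<Longrightarrow> z < x \<Longrightarrow> ?R z" for x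
  proof -
    have "\<forall>\<^sub>F z in at_left x. \<tau> j < ereal x \<longrightarrow> \<tau> j < ereal z" for j
    proof (cases "\<tau> j < ereal x")
      case True
      then obtain r where r: "\<tau> j < ereal r" "r < x" using ereal_dense2[of "\<tau> j" "ereal x"] by auto
      show ?thesis using eventually_at_left_real[OF r(2)]
        by eventually_elim (use r(1) in \<open>auto elim: less_trans\<close>)
    qed simp
    then have "\<forall>\<^sub>F z in at_left x. \<forall>j\<in>{1..B}. \<tau> j < ereal x \<longrightarrow> \<tau> j < ereal z"
      by (intro eventually_ball_finite) auto
    then have "\<forall>\<^sub>F z in at_left x. ?R x"
      using eventually_at_left_real[OF x]
    proof eventually_elim
      case (elim z)
      show ?case by (rule mono[OF _ le[of z]]) (use elim in auto)
    qed
    then show ?thesis by simp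
  qed
  note G = greatest_unit_interval[of ?R, OF 0 down left, folded crit_def]
  show "crit B \<alpha> \<tau> \<in> {0..1}" by (rule G(1))
  show "l \<in> {0..1} \<Longrightarrow> ?R l \<longleftrightarrow> l \<le> crit B \<alpha> \<tau>" by (rule G(2))
qed

text \<open>Monotonicity is stated through comparison with the levels in the unit interval, because that
  is the form in which \<open>Psi_less_antimono\<close> compares statistics.\<close>
lemma crit_mono:
  assumes "0 \<le> \<alpha>" "\<And>j. j \<in> {1..B} \<Longrightarrow> 0 \<le> \<tau> j" "\<And>j. j \<in> {1..B} \<Longrightarrow> 0 \<le> \<tau>' j"
    and less: "\<And>j l. j \<in> {1..B} \<Longrightarrow> l \<in> {0..1} \<Longrightarrow> \<tau>' j < ereal l \<Longrightarrow> \<tau> j < ereal l"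
  shows "crit B \<alpha> \<tau> \<le> crit B \<alpha> \<tau>'"
proof -
  let ?l = "crit B \<alpha> \<tau>"
  have l: "?l \<in> {0..1}" by (rule crit_props) (use assms in auto)
  have "(\<Sum>j=1..B. of_bool (\<tau>' j < ereal ?l)) \<le> (\<Sum>j=1..B. of_bool (\<tau> j < ereal ?l) :: real)"
    by (intro sum_mono) (use less l in auto)
  then have "(\<Sum>j=1..B. of_bool (\<tau>' j < ereal ?l)) / real B
      \<le> (\<Sum>j=1..B. of_bool (\<tau> j < ereal ?l)) / real B"
    by (rule divide_right_mono) simp
  also have "\<dots> \<le> \<alpha>" using crit_props(2)[of \<alpha> B \<tau> ?l] assms l by auto
  finally show ?thesis using crit_props(2)[of \<alpha> B \<tau>' ?l] assms l by auto
qed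

lemma crit_measurable:
  assumes \<alpha>: "0 \<le> \<alpha>"
    and meas: "\<And>j. j \<in> {1..B} \<Longrightarrow> (\<lambda>z. \<tau> z j) \<in> borel_measurable N"
    and pos: "\<And>j z. z \<in> space N \<Longrightarrow> j \<in> {1..B} \<Longrightarrow> 0 \<le> \<tau> z j"
  shows "(\<lambda>z. crit B \<alpha> (\<tau> z)) \<in> borel_measurable N"
  unfolding borel_measurable_iff_ge
proof
  fix a :: real
  have c01: "crit B \<alpha> (\<tau> z) \<in> {0..1}" if "z \<in> space N" for z
    by (rule crit_props(1)) (use \<alpha> pos that in auto)
  have crit: "a \<in> {0..1} \<Longrightarrow> (\<Sum>j=1..B. of_bool (\<tau> z j < ereal a)) / real B \<le> \<alpha>
      \<longleftrightarrow> a \<le> crit B \<alpha> (\<tau> z)" if "z \<in> space N" for z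
    by (rule crit_props(2)) (use \<alpha> pos that in auto)
  consider "a < 0" | "a \<in> {0..1}" | "1 < a" by force
  then show "{z \<in> space N. a \<le> crit B \<alpha> (\<tau> z)} \<in> sets N"
  proof cases
    case 1
    then have "{z \<in> space N. a \<le> crit B \<alpha> (\<tau> z)} = space N" using c01 by force
    then show ?thesis by (simp only: sets.top)
  next
    case 2
    have [measurable]: "(\<lambda>z. of_bool (\<tau> z j < ereal a) :: real) \<in> borel_measurable N" if "j \<in> {1..B}" for j
      using meas[OF that] by measurable
    have "{z \<in> space N. a \<le> crit B \<alpha> (\<tau> z)} =
        {z \<in> space N. (\<Sum>j=1..B. of_bool (\<tau> z j < ereal a)) / real B \<le> \<alpha>}"
      using crit 2 by blast
    also have "\<dots> \<in> sets N" by measurable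
    finally show ?thesis .
  next
    case 3
    then have "{z \<in> space N. a \<le> crit B \<alpha> (\<tau> z)} = {}" using c01 by force
    then show ?thesis by (simp only: sets.empty_sets)
  qed
qed

lemma crit_cong:
  assumes "\<And>j. j \<in> {1..B} \<Longrightarrow> \<tau> j = \<tau>' j"
  shows "crit B \<alpha> \<tau> = crit B \<alpha> \<tau>'"
proof -
  have "(\<Sum>j=1..B. of_bool (\<tau> j < ereal l)) = (\<Sum>j=1..B. of_bool (\<tau>' j < ereal l) :: real)" for l
    by (intro sum.cong) (simp_all add: assms)
  then show ?thesis by (simp add: crit_def)
qed

text \<open>The critical value is a symmetric function of the statistics.\<close>
lemma crit_permute:
  assumes "\<pi> permutes {1..B}"
  shows "crit B \<alpha> (\<lambda>j. \<tau> (\<pi> j)) = crit B \<alpha> \<tau>"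
proof -
  have "(\<Sum>j=1..B. of_bool (\<tau> (\<pi> j) < ereal l)) = (\<Sum>j=1..B. of_bool (\<tau> j < ereal l) :: real)" for l
    using sum.permute[OF assms, of "\<lambda>j. of_bool (\<tau> j < ereal l) :: real"] by (simp add: o_def)
  then show ?thesis by (simp add: crit_def)
qed

section \<open>Order statistics and the statistic \<open>Psi\<close>\<close>

lemma sorted_nth_less_iff:
  fixes xs :: "real list"
  assumes "sorted xs" "n < length xs"
  shows "xs ! n < y \<longleftrightarrow> n < length (filter (\<lambda>x. x < y) xs)"
  using assms
proof (induction xs arbitrary: n)
  case (Cons a xs)
  show ?case
  proof (cases "a < y")
    case True
    then show ?thesis using Cons by (cases n) auto
  next
    case False
    then have "\<forall>x\<in>set (a # xs). \<not> x < y" using Cons.prems(1) by fastforce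
    then show ?thesis using Cons.prems(2) nth_mem[of n "a # xs"] by (auto simp: filter_empty_conv)
  qed
qed simp

lemma order_stat_less_iff:
  assumes A: "finite A" and k: "k \<in> {1..card A}"
  shows "order_stat q A k < y \<longleftrightarrow> k \<le> card {i \<in> A. q i < y}"
proof -
  let ?xs = "sorted_list_of_multiset (image_mset q (mset_set A))"
  have len: "length ?xs = card A" by (metis mset_sorted_list_of_multiset size_image_mset size_mset size_mset_set)
  have "length (filter (\<lambda>x. x < y) ?xs) = size (filter_mset (\<lambda>x. x < y) (image_mset q (mset_set A)))"
    by (metis mset_filter mset_sorted_list_of_multiset size_mset)
  also have "\<dots> = card {i \<in> A. q i < y}"
    using A by (simp add: filter_mset_image_mset filter_mset_mset_set)
  finally have "length (filter (\<lambda>x. x < y) ?xs) = card {i \<in> A. q i < y}" .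
  then show ?thesis
    using sorted_nth_less_iff[of ?xs "k - 1" y] k len unfolding order_stat_def by (simp, arith)
qed

lemma order_stat_nonneg:
  assumes "finite A" "k \<in> {1..card A}" "\<And>i. i \<in> A \<Longrightarrow> 0 \<le> q i"
  shows "0 \<le> order_stat q A k"
proof -
  have "{i \<in> A. q i < 0} = {}" using assms(3) by force
  then have "card {i \<in> A. q i < 0} = 0" by (simp only: card.empty)
  then show ?thesis using order_stat_less_iff[OF assms(1,2), of q 0] assms(2) by auto
qed

text \<open>For \<open>k > card A\<close> the condition on the right fails by itself, so \<open>k\<close> ranges up to \<open>K\<close> instead of
  \<open>min K (card A)\<close>.\<close>
lemma Psi_less_iff:
  assumes tpl: "is_template K t" and A: "finite A" and q: "\<And>i. i \<in> A \<Longrightarrow> 0 \<le> q i x"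
    and l: "l \<in> {0..1}"
  shows "Psi q K t x A < ereal l \<longleftrightarrow> (\<exists>k\<in>{1..K}. k \<le> card {i \<in> A. q i x < t k l})"
proof -
  have eq: "gen_inverse (t k) (order_stat (\<lambda>i. q i x) A k) < l \<longleftrightarrow> k \<le> card {i \<in> A. q i x < t k l}"
    if "k \<in> {1..min K (card A)}" for k
  proof -
    have "0 \<le> order_stat (\<lambda>i. q i x) A k" by (rule order_stat_nonneg) (use A q that in auto)
    then have "t k l \<le> order_stat (\<lambda>i. q i x) A k
        \<longleftrightarrow> l \<le> gen_inverse (t k) (order_stat (\<lambda>i. q i x) A k)"
      using gen_inverse_props(2)[OF tpl _ _ l, of k] that by auto
    then show ?thesis using order_stat_less_iff[OF A, of k "\<lambda>i. q i x" "t k l"] that by auto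
  qed
  have "k \<le> card A" if "k \<le> card {i \<in> A. q i x < t k l}" for k
    using that card_mono[OF A, of "{i \<in> A. q i x < t k l}"] by auto
  then have "(\<exists>k\<in>{1..K}. k \<le> card {i \<in> A. q i x < t k l})
      \<longleftrightarrow> (\<exists>k\<in>{1..min K (card A)}. k \<le> card {i \<in> A. q i x < t k l})"
    by auto
  also have "\<dots> \<longleftrightarrow> Psi q K t x A < ereal l"
    unfolding Psi_def INF_less_iff using eq by simp
  finally show ?thesis by simp
qed

lemma Psi_nonneg:
  assumes tpl: "is_template K t" and A: "finite A" and q: "\<And>i. i \<in> A \<Longrightarrow> 0 \<le> q i x"
  shows "0 \<le> Psi q K t x A"
proof -
  have "{i \<in> A. q i x < t k 0} = {}" if "k \<in> {1..K}" for k
  proof -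
    have "t k 0 = 0" using tpl that by (simp add: is_template_def)
    then show ?thesis using q by (simp add: not_less)
  qed
  then have "card {i \<in> A. q i x < t k 0} = 0" if "k \<in> {1..K}" for k
    using that by (metis card.empty)
  then have no: "\<not> k \<le> card {i \<in> A. q i x < t k 0}" if "k \<in> {1..K}" for k
    using that by simp
  have "\<not> Psi q K t x A < ereal 0"
  proof -
    have "Psi q K t x A < ereal 0 \<longleftrightarrow> (\<exists>k\<in>{1..K}. k \<le> card {i \<in> A. q i x < t k 0})"
      by (rule Psi_less_iff) (use assms in auto)
    then show ?thesis using no by blast
  qed
  then show ?thesis by (simp add: zero_ereal_def)
qed

lemma Psi_less_antimono:
  assumes "is_template K t" "A \<subseteq> A'" "finite A'" "\<And>i. i \<in> A' \<Longrightarrow> 0 \<le> q i x"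
    and "l \<in> {0..1}" "Psi q K t x A < ereal l"
  shows "Psi q K t x A' < ereal l"
proof -
  have "card {i \<in> A. q i x < t k l} \<le> card {i \<in> A'. q i x < t k l}" for k
    using assms by (intro card_mono) auto
  moreover obtain k where "k \<in> {1..K}" "k \<le> card {i \<in> A. q i x < t k l}"
  proof -
    have "Psi q K t x A < ereal l \<longleftrightarrow> (\<exists>k\<in>{1..K}. k \<le> card {i \<in> A. q i x < t k l})"
      by (rule Psi_less_iff) (use assms finite_subset[of A A'] in auto)
    then show ?thesis using assms(6) that by blast
  qed
  ultimately have "\<exists>k\<in>{1..K}. k \<le> card {i \<in> A'. q i x < t k l}"
    using order_trans by blast
  then show ?thesis using Psi_less_iff[of K t A' q x l] assms by simp
qed

lemma Psi_cong:
  assumes "finite A" "\<And>i. i \<in> A \<Longrightarrow> q i x = q' i x'"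
  shows "Psi q K t x A = Psi q' K t x' A"
proof -
  have "image_mset (\<lambda>i. q i x) (mset_set A) = image_mset (\<lambda>i. q' i x') (mset_set A)"
    by (rule image_mset_cong) (use assms in auto)
  then show ?thesis by (simp add: Psi_def order_stat_def)
qed

lemma Psi_measurable:
  assumes tpl: "is_template K t" and A: "finite A"
    and meas: "\<And>i. i \<in> A \<Longrightarrow> q i \<in> borel_measurable N"
    and pos: "\<And>i z. i \<in> A \<Longrightarrow> z \<in> space N \<Longrightarrow> 0 \<le> q i z"
  shows "(\<lambda>z. Psi q K t z A) \<in> borel_measurable N"
  unfolding Psi_def
proof (rule borel_measurable_INF)
  fix k assume k: "k \<in> {1..min K (card A)}"
  let ?f = "\<lambda>z. gen_inverse (t k) (order_stat (\<lambda>i. q i z) A k)"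
  have kK: "k \<in> {1..K}" and kA: "k \<in> {1..card A}" using k by auto
  have os: "0 \<le> order_stat (\<lambda>i. q i z) A k" if "z \<in> space N" for z
    by (rule order_stat_nonneg[OF A kA]) (use pos that in auto)
  have f01: "?f z \<in> {0..1}" if "z \<in> space N" for z
    by (rule gen_inverse_props(1)[OF tpl kK os[OF that]])
  have "?f \<in> borel_measurable N"
    unfolding borel_measurable_iff_ge
  proof
    fix a :: real
    consider "a < 0" | "a \<in> {0..1}" | "1 < a" by force
    then show "{z \<in> space N. a \<le> ?f z} \<in> sets N"
    proof cases
      case 1
      then have "{z \<in> space N. a \<le> ?f z} = space N" using f01 by force
      then show ?thesis by (simp only: sets.top)
    next
      case 2
      have "a \<le> ?f z \<longleftrightarrow> \<not> k \<le> card {i \<in> A. q i z < t k a}" if "z \<in> space N" for z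
        using gen_inverse_props(2)[OF tpl kK os[OF that] 2] order_stat_less_iff[OF A kA, of "\<lambda>i. q i z" "t k a"]
        by auto
      moreover have "card {i \<in> A. q i z < t k a} = (\<Sum>i\<in>A. of_bool (q i z < t k a))" for z
        using A by (simp add: of_bool_def sum.If_cases Int_def)
      ultimately have "{z \<in> space N. a \<le> ?f z} = {z \<in> space N. \<not> k \<le> (\<Sum>i\<in>A. of_bool (q i z < t k a))}"
        by auto
      also have "\<dots> \<in> sets N"
      proof -
        have [measurable]: "(\<lambda>z. of_bool (q i z < t k a) :: nat) \<in> measurable N (count_space UNIV)"
          if "i \<in> A" for i using meas[OF that] by measurable
        show ?thesis by measurable
      qed
      finally show ?thesis .
    next
      case 3
      then have "{z \<in> space N. a \<le> ?f z} = {}" using f01 by force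
      then show ?thesis by (simp only: sets.empty_sets)
    qed
  qed
  then show "(\<lambda>z. ereal (?f z)) \<in> borel_measurable N" by measurable
qed simp

section \<open>Randomisation by a finite group\<close>

text \<open>Hypothesis \<open>inv\<close> says that translating all group elements by \<open>h\<close> does not change the joint law
  of the statistics \<open>S h'\<close>, \<open>h' \<in> carrier G\<close>. The conclusion averages over the tuples with first
  entry \<open>\<one>\<close>, which are the possible values of \<open>(g 1, \<dots>, g B)\<close>.\<close>
lemma randomization_average_bound:
  fixes G (structure) and S :: "'g \<Rightarrow> 'x \<Rightarrow> ereal"
  assumes grp: "group G" and fin: "finite (carrier G)" and P: "prob_space P"
    and \<alpha>: "0 \<le> \<alpha>" and B: "1 \<le> B"
    and meas: "\<And>h. h \<in> carrier G \<Longrightarrow> S h \<in> borel_measurable P"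
    and pos: "\<And>h x. h \<in> carrier G \<Longrightarrow> x \<in> space P \<Longrightarrow> 0 \<le> S h x"
    and inv: "\<And>h. h \<in> carrier G \<Longrightarrow>
        distr P (Pi\<^sub>M (carrier G) (\<lambda>_. borel)) (\<lambda>x. \<lambda>h'\<in>carrier G. S h' x)
      = distr P (Pi\<^sub>M (carrier G) (\<lambda>_. borel)) (\<lambda>x. \<lambda>h'\<in>carrier G. S (h' \<otimes> h) x)"
  defines "U \<equiv> {u \<in> {1..B} \<rightarrow>\<^sub>E carrier G. u 1 = \<one>}"
  shows "(\<Sum>u\<in>U. measure P {x \<in> space P. S (u 1) x < ereal (crit B \<alpha> (\<lambda>j. S (u j) x))})
    \<le> \<alpha> * card U"
proof -
  interpret group G by (rule grp)
  interpret P: prob_space P by (rule P)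
  let ?N = "Pi\<^sub>M (carrier G) (\<lambda>_. borel) :: ('g \<Rightarrow> ereal) measure"
  define D where "D i u = {x \<in> space P. S (u i) x < ereal (crit B \<alpha> (\<lambda>j. S (u j) x))}" for i u
  have finU: "finite U" unfolding U_def
    by (rule finite_subset[OF _ finite_PiE[of "{1..B}" "\<lambda>_. carrier G"]]) (use fin in blast)+
  have UG: "u j \<in> carrier G" if "u \<in> U" "j \<in> {1..B}" for u j
    using that by (auto simp: U_def)
  have crit_meas: "(\<lambda>x. crit B \<alpha> (\<lambda>j. S (u j) x)) \<in> borel_measurable P"
    if "\<And>j. j \<in> {1..B} \<Longrightarrow> u j \<in> carrier G" for u
    by (rule crit_measurable[OF \<alpha>]) (use that meas pos in auto)
  have D_sets: "D i u \<in> sets P" if "i \<in> {1..B}" "\<And>j. j \<in> {1..B} \<Longrightarrow> u j \<in> carrier G" for i u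
  proof -
    have [measurable]: "S (u i) \<in> borel_measurable P"
      "(\<lambda>x. crit B \<alpha> (\<lambda>j. S (u j) x)) \<in> borel_measurable P"
      using that meas crit_meas by auto
    show ?thesis unfolding D_def by measurable
  qed
  \<comment> \<open>The truncation \<open>max 0\<close> does not affect the nonnegative statistics, but is needed on the product
    space, where coordinates may be negative and the maximum in \<open>crit\<close> need not exist.\<close>
  have shift: "measure P (D i u) = measure P (D i (\<lambda>j. u j \<otimes> h))"
    if i: "i \<in> {1..B}" and u: "\<And>j. j \<in> {1..B} \<Longrightarrow> u j \<in> carrier G" and h: "h \<in> carrier G" for i u h
  proof -
    let ?E = "{y \<in> space ?N. max 0 (y (u i)) < ereal (crit B \<alpha> (\<lambda>j. max 0 (y (u j))))}"
    have [measurable]: "(\<lambda>y. y (u j)) \<in> borel_measurable ?N" if "j \<in> {1..B}" for j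
      using measurable_component_singleton[of "u j" "carrier G" "\<lambda>_. borel"] u[OF that] by simp
    have [measurable]: "(\<lambda>y. y (u i)) \<in> borel_measurable ?N" using i by measurable
    have [measurable]: "(\<lambda>y. crit B \<alpha> (\<lambda>j. max 0 (y (u j)))) \<in> borel_measurable ?N"
      by (rule crit_measurable[OF \<alpha>]) auto
    have E: "?E \<in> sets ?N" by measurable
    have *: "measure (distr P ?N (\<lambda>x. \<lambda>h'\<in>carrier G. S (f h') x)) ?E = measure P (D i (\<lambda>j. f (u j)))"
      if f: "f \<in> carrier G \<rightarrow> carrier G" for f
    proof -
      have m: "(\<lambda>x. \<lambda>h'\<in>carrier G. S (f h') x) \<in> P \<rightarrow>\<^sub>M ?N"
        by (rule measurable_restrict) (use f meas in auto)
      have fu: "f (u j) \<in> carrier G" if "j \<in> {1..B}" for j using f u that by auto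
      let ?y = "\<lambda>x. \<lambda>h'\<in>carrier G. S (f h') x"
      have "?y -` ?E \<inter> space P = D i (\<lambda>j. f (u j))"
      proof (rule Set.set_eqI)
        fix x
        have "?y x \<in> ?E \<longleftrightarrow> S (f (u i)) x < ereal (crit B \<alpha> (\<lambda>j. S (f (u j)) x))"
          if x: "x \<in> space P"
        proof -
          have max: "max 0 (?y x (u j)) = S (f (u j)) x" if "j \<in> {1..B}" for j
            using u fu pos x that by (auto simp: max_def)
          have "crit B \<alpha> (\<lambda>j. max 0 (?y x (u j))) = crit B \<alpha> (\<lambda>j. S (f (u j)) x)"
            by (rule crit_cong[OF max])
          then show ?thesis
            using measurable_space[OF m x] by (simp only: mem_Collect_eq max[OF i] simp_thms)
        qed
        then show "x \<in> ?y -` ?E \<inter> space P \<longleftrightarrow> x \<in> D i (\<lambda>j. f (u j))"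
          unfolding D_def by blast
      qed
      then show ?thesis using measure_distr[OF m E] by simp
    qed
    show ?thesis using *[of "\<lambda>h'. h'"] *[of "\<lambda>h'. h' \<otimes> h"] inv[OF h] h by auto
  qed
  \<comment> \<open>Translate so that entry \<open>i\<close> becomes \<open>\<one>\<close>, then exchange the entries \<open>1\<close> and \<open>i\<close>; since \<open>u 1 = \<one>\<close>,
    this is an involution of \<open>U\<close>.\<close>
  define s where "s i u = (\<lambda>j\<in>{1..B}. u (Transposition.transpose 1 i j) \<otimes> inv (u i))" for i and u :: "nat \<Rightarrow> 'g"
  have tr: "Transposition.transpose 1 i j \<in> {1..B}" if "i \<in> {1..B}" "j \<in> {1..B}" for i j :: nat
    using that by (auto simp: Transposition.transpose_def)
  have s_U: "s i u \<in> U" if "u \<in> U" "i \<in> {1..B}" for i u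
    using UG[OF that(1)] that B tr[OF that(2)] by (auto simp: s_def U_def)
  have s_s: "s i (s i u) = u" if "u \<in> U" "i \<in> {1..B}" for i u
  proof
    fix j
    have u1: "u 1 = \<one>" using that by (simp add: U_def)
    note uG = UG[OF that(1)]
    have si: "s i u i = inv (u i)" using that u1 uG[OF that(2)] by (simp add: s_def)
    show "s i (s i u) j = u j"
    proof (cases "j \<in> {1..B}")
      case True
      have "s i (s i u) j = s i u (Transposition.transpose 1 i j) \<otimes> inv (s i u i)" using True by (simp add: s_def)
      also have "s i u (Transposition.transpose 1 i j) = u j \<otimes> inv (u i)"
        using tr[OF that(2) True] by (simp add: s_def)
      finally show ?thesis using uG[OF True] uG[OF that(2)] by (simp add: si m_assoc)
    next
      case False
      then have "s i (s i u) j = undefined"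
        unfolding s_def[of i "s i u"] by (simp only: restrict_apply if_False)
      also have "undefined = u j" using that(1) False by (auto simp: U_def PiE_def extensional_def)
      finally show ?thesis .
    qed
  qed
  have D_s: "measure P (D i u) = measure P (D 1 (s i u))" if "u \<in> U" "i \<in> {1..B}" for i u
  proof -
    note uG = UG[OF that(1)]
    have "measure P (D i u) = measure P (D i (\<lambda>j. u j \<otimes> inv (u i)))"
      using shift[of i u "inv (u i)"] uG that by simp
    also have "D i (\<lambda>j. u j \<otimes> inv (u i)) = D 1 (s i u)"
    proof -
      have "crit B \<alpha> (\<lambda>j. S (s i u j) x) = crit B \<alpha> (\<lambda>j. S (u j \<otimes> inv (u i)) x)" for x
      proof -
        have "crit B \<alpha> (\<lambda>j. S (s i u j) x) = crit B \<alpha> (\<lambda>j. S (u (Transposition.transpose 1 i j) \<otimes> inv (u i)) x)"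
          by (rule crit_cong) (simp add: s_def)
        also have "\<dots> = crit B \<alpha> (\<lambda>j. S (u j \<otimes> inv (u i)) x)"
          by (rule crit_permute[of "Transposition.transpose 1 i" B \<alpha> "\<lambda>j. S (u j \<otimes> inv (u i)) x"])
            (use that B in \<open>auto intro: permutes_swap_id\<close>)
        finally show ?thesis .
      qed
      moreover have "s i u 1 = u i \<otimes> inv (u i)" using B by (simp add: s_def)
      ultimately show ?thesis unfolding D_def by simp
    qed
    finally show ?thesis .
  qed
  have sum_D: "(\<Sum>u\<in>U. measure P (D i u)) = (\<Sum>u\<in>U. measure P (D 1 u))" if "i \<in> {1..B}" for i
  proof (rule sum.reindex_bij_witness[of _ "s i" "s i"])
    fix u assume u: "u \<in> U"
    show "s i (s i u) = u" "s i (s i u) = u" by (rule s_s[OF u that])+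
    show "s i u \<in> U" "s i u \<in> U" by (rule s_U[OF u that])+
    show "measure P (D 1 (s i u)) = measure P (D i u)" by (rule D_s[OF u that, symmetric])
  qed
  \<comment> \<open>Pointwise, at most \<open>\<alpha> * B\<close> of the statistics lie below their critical value.\<close>
  have le: "(\<Sum>i=1..B. measure P (D i u)) \<le> \<alpha> * B" if "u \<in> U" for u
  proof -
    note uG = UG[OF that]
    have ind: "integrable P (indicat_real (D i u))" if "i \<in> {1..B}" for i
      using D_sets[OF that uG] by (intro integrable_real_indicator) (auto simp: P.emeasure_eq_measure)
    have "(\<Sum>i=1..B. measure P (D i u)) = (\<Sum>i=1..B. integral\<^sup>L P (indicat_real (D i u)))"
      using D_sets[OF _ uG] by (intro sum.cong) (auto simp: Int_absorb2 D_def)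
    also have "\<dots> = (\<integral>x. (\<Sum>i=1..B. indicat_real (D i u) x) \<partial>P)"
      using ind by (simp add: Bochner_Integration.integral_sum)
    also have "\<dots> \<le> (\<integral>x. \<alpha> * B \<partial>P)"
    proof (rule integral_mono)
      fix x assume x: "x \<in> space P"
      let ?c = "crit B \<alpha> (\<lambda>j. S (u j) x)"
      have "?c \<in> {0..1}" by (rule crit_props(1)) (use \<alpha> uG pos x in auto)
      then have "(\<Sum>j=1..B. of_bool (S (u j) x < ereal ?c)) / real B \<le> \<alpha>"
        using crit_props(2)[of \<alpha> B "\<lambda>j. S (u j) x" ?c] \<alpha> uG pos x by auto
      then have "(\<Sum>j=1..B. of_bool (S (u j) x < ereal ?c)) \<le> \<alpha> * B"
        using B by (simp add: field_simps)
      moreover have "indicat_real (D i u) x = of_bool (S (u i) x < ereal ?c)" for i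
        using x by (simp add: D_def indicator_def)
      ultimately show "(\<Sum>i=1..B. indicat_real (D i u) x) \<le> \<alpha> * B" by simp
    qed (use ind in auto)
    also have "\<dots> = \<alpha> * B" by (simp add: P.prob_space)
    finally show ?thesis .
  qed
  have "B * (\<Sum>u\<in>U. measure P (D 1 u)) = (\<Sum>i=1..B. \<Sum>u\<in>U. measure P (D 1 u))" by simp
  also have "\<dots> = (\<Sum>i=1..B. \<Sum>u\<in>U. measure P (D i u))"
    by (rule sum.cong[OF refl sum_D[symmetric]])
  also have "\<dots> = (\<Sum>u\<in>U. \<Sum>i=1..B. measure P (D i u))" by (rule sum.swap)
  also have "\<dots> \<le> (\<Sum>u\<in>U. \<alpha> * B)" by (rule sum_mono[OF le])
  also have "\<dots> = B * (\<alpha> * card U)" by simp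
  finally show ?thesis using B by (simp add: D_def)
qed

text \<open>Independence of \<open>g 2, \<dots>, g B\<close>, their uniform law, and their independence from \<open>X\<close> combine into:
  the tuple \<open>(g 1, \<dots>, g B)\<close> is uniform on \<open>U\<close> and independent of \<open>X\<close>.\<close>
lemma random_group_elements_law:
  fixes G (structure) and g :: "nat \<Rightarrow> 'w \<Rightarrow> 'g" and X :: "'w \<Rightarrow> 'x"
  assumes fin: "finite (carrier G)" and Q: "prob_space Q" and B: "2 \<le> B"
    and X: "X \<in> Q \<rightarrow>\<^sub>M M"
    and g1: "\<And>\<omega>. \<omega> \<in> space Q \<Longrightarrow> g 1 \<omega> = \<one>"
    and g_meas: "\<And>j. j \<in> {2..B} \<Longrightarrow> g j \<in> Q \<rightarrow>\<^sub>M count_space (carrier G)"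
    and g_unif: "\<And>j. j \<in> {2..B} \<Longrightarrow>
          distr Q (count_space (carrier G)) (g j) = uniform_count_measure (carrier G)"
    and g_indep: "prob_space.indep_vars Q (\<lambda>_. count_space (carrier G)) g {2..B}"
    and g_indep_X: "prob_space.indep_set Q (sets (vimage_algebra (space Q) X M))
            (sets (vimage_algebra (space Q) (\<lambda>\<omega>. \<lambda>j\<in>{2..B}. g j \<omega>)
               (Pi\<^sub>M {2..B} (\<lambda>_. count_space (carrier G)))))"
    and one: "\<one> \<in> carrier G"
  defines "U \<equiv> {u \<in> {1..B} \<rightarrow>\<^sub>E carrier G. u 1 = \<one>}"
  assumes u: "u \<in> U" and C: "C \<in> sets M"
  shows "measure Q {\<omega> \<in> space Q. X \<omega> \<in> C \<and> (\<forall>j\<in>{1..B}. g j \<omega> = u j)}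
    = measure (distr Q M X) C / card U"
proof -
  interpret Q: prob_space Q by (rule Q)
  let ?c = "(1 / real (card (carrier G))) ^ card {2..B}"
  define F where "F v = {\<omega> \<in> space Q. \<forall>j\<in>{1..B}. g j \<omega> = v j}" for v
  have finU: "finite U" unfolding U_def
    by (rule finite_subset[OF _ finite_PiE[of "{1..B}" "\<lambda>_. carrier G"]]) (use fin in blast)+
  have UG: "v j \<in> carrier G" if "v \<in> U" "j \<in> {1..B}" for v j
    using that by (auto simp: U_def)
  have split: "{1..B} = insert 1 {2..B}" using B by auto
  have F_alt: "F v = (\<Inter>j\<in>{2..B}. g j -` {v j} \<inter> space Q)" if "v \<in> U" for v
    using that g1 B unfolding F_def split U_def by auto
  have F_sets: "F v \<in> sets Q" if "v \<in> U" for v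
    unfolding F_alt[OF that] using UG[OF that] B
    by (intro sets.finite_INT measurable_sets[OF g_meas]) auto
  have F_prob: "Q.prob (F v) = ?c" if v: "v \<in> U" for v
  proof -
    have one: "Q.prob (g j -` {v j} \<inter> space Q) = 1 / card (carrier G)" if j: "j \<in> {2..B}" for j
    proof -
      have "Q.prob (g j -` {v j} \<inter> space Q) = measure (distr Q (count_space (carrier G)) (g j)) {v j}"
        using UG[OF v, of j] j by (subst measure_distr[OF g_meas[OF j]]) auto
      also have "\<dots> = 1 / card (carrier G)"
        using UG[OF v, of j] j fin by (simp add: g_unif[OF j] measure_uniform_count_measure)
      finally show ?thesis .
    qed
    have "Q.prob (F v) = (\<Prod>j\<in>{2..B}. Q.prob (g j -` {v j} \<inter> space Q))"
      unfolding F_alt[OF v] using UG[OF v] B by (intro Q.indep_varsD_finite[OF g_indep]) auto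
    also have "\<dots> = (\<Prod>j\<in>{2..B}. 1 / card (carrier G))" by (rule prod.cong) (use one in auto)
    finally show ?thesis by simp
  qed
  \<comment> \<open>The events \<open>F v\<close> partition the space, so their common probability \<open>?c\<close> is \<open>1 / card U\<close>.\<close>
  have "(\<Union>v\<in>U. F v) = space Q"
  proof safe
    fix \<omega> assume \<omega>: "\<omega> \<in> space Q"
    have "(\<lambda>j\<in>{1..B}. g j \<omega>) \<in> U"
      using g1[OF \<omega>] one B measurable_space[OF g_meas \<omega>] unfolding U_def split by auto
    then show "\<omega> \<in> (\<Union>v\<in>U. F v)" using \<omega> by (intro UN_I) (auto simp: F_def)
  qed (auto simp: F_def)
  moreover have "disjoint_family_on F U"
    unfolding disjoint_family_on_def
  proof safe
    fix v w \<omega> assume "v \<in> U" "w \<in> U" "\<omega> \<in> F v" "\<omega> \<in> F w"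
    then have "v j = w j" for j
      by (cases "j \<in> {1..B}") (auto simp: F_def U_def PiE_def extensional_def)
    then have "v = w" by blast
    moreover assume "v \<noteq> w"
    ultimately show "\<omega> \<in> {}" by simp
  qed
  ultimately have "1 = (\<Sum>v\<in>U. Q.prob (F v))"
    using Q.finite_measure_finite_Union[OF finU, of F] F_sets Q.prob_space by auto
  also have "\<dots> = card U * ?c" using F_prob by simp
  finally have c: "?c = 1 / card U" by (simp add: field_simps)
  let ?h = "\<lambda>\<omega>. \<lambda>j\<in>{2..B}. g j \<omega>"
  let ?A = "(\<Pi>\<^sub>E j\<in>{2..B}. {u j})"
  have A: "?A \<in> sets (Pi\<^sub>M {2..B} (\<lambda>_. count_space (carrier G)))"
    by (rule sets_PiM_I_finite) (use UG[OF u] in auto)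
  have F_pre: "F u = ?h -` ?A \<inter> space Q"
    unfolding F_alt[OF u] using B by (auto simp: PiE_iff)
  have "{\<omega> \<in> space Q. X \<omega> \<in> C \<and> (\<forall>j\<in>{1..B}. g j \<omega> = u j)} = (X -` C \<inter> space Q) \<inter> F u"
    by (auto simp: F_def)
  also have "Q.prob \<dots> = Q.prob (X -` C \<inter> space Q) * Q.prob (F u)"
    using in_vimage_algebra[OF C, of X "space Q"] in_vimage_algebra[OF A, of ?h "space Q"]
    unfolding F_pre by (intro Q.indep_setD[OF g_indep_X]) auto
  also have "\<dots> = measure (distr Q M X) C / card U"
    by (simp only: F_prob[OF u] c measure_distr[OF X C]) simp
  finally show ?thesis .
qed

text \<open>The level of the randomisation test for a general statistic \<open>S\<close>.\<close>
lemma randomization_level: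
  fixes G (structure) and g :: "nat \<Rightarrow> 'w \<Rightarrow> 'g" and X :: "'w \<Rightarrow> 'x" and S :: "'g \<Rightarrow> 'x \<Rightarrow> ereal"
  assumes grp: "group G" and fin: "finite (carrier G)" and Q: "prob_space Q" and B: "2 \<le> B"
    and \<alpha>: "0 \<le> \<alpha>"
    and X: "X \<in> Q \<rightarrow>\<^sub>M M"
    and g1: "\<And>\<omega>. \<omega> \<in> space Q \<Longrightarrow> g 1 \<omega> = \<one>"
    and g_meas: "\<And>j. j \<in> {2..B} \<Longrightarrow> g j \<in> Q \<rightarrow>\<^sub>M count_space (carrier G)"
    and g_unif: "\<And>j. j \<in> {2..B} \<Longrightarrow>
          distr Q (count_space (carrier G)) (g j) = uniform_count_measure (carrier G)"
    and g_indep: "prob_space.indep_vars Q (\<lambda>_. count_space (carrier G)) g {2..B}"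
    and g_indep_X: "prob_space.indep_set Q (sets (vimage_algebra (space Q) X M))
            (sets (vimage_algebra (space Q) (\<lambda>\<omega>. \<lambda>j\<in>{2..B}. g j \<omega>)
               (Pi\<^sub>M {2..B} (\<lambda>_. count_space (carrier G)))))"
    and meas: "\<And>h. h \<in> carrier G \<Longrightarrow> S h \<in> borel_measurable M"
    and pos: "\<And>h x. h \<in> carrier G \<Longrightarrow> x \<in> space M \<Longrightarrow> 0 \<le> S h x"
    and inv: "\<And>h. h \<in> carrier G \<Longrightarrow>
        distr (distr Q M X) (Pi\<^sub>M (carrier G) (\<lambda>_. borel)) (\<lambda>x. \<lambda>h'\<in>carrier G. S h' x)
      = distr (distr Q M X) (Pi\<^sub>M (carrier G) (\<lambda>_. borel)) (\<lambda>x. \<lambda>h'\<in>carrier G. S (h' \<otimes> h) x)"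
  shows "measure Q {\<omega> \<in> space Q. S \<one> (X \<omega>) < ereal (crit B \<alpha> (\<lambda>j. S (g j \<omega>) (X \<omega>)))} \<le> \<alpha>"
proof -
  interpret group G by (rule grp)
  interpret Q: prob_space Q by (rule Q)
  let ?P = "distr Q M X"
  define U where "U = {u \<in> {1..B} \<rightarrow>\<^sub>E carrier G. u 1 = \<one>}"
  define D where "D u = {x \<in> space M. S (u 1) x < ereal (crit B \<alpha> (\<lambda>j. S (u j) x))}" for u
  define E where "E u = {\<omega> \<in> space Q. X \<omega> \<in> D u \<and> (\<forall>j\<in>{1..B}. g j \<omega> = u j)}" for u
  have finU: "finite U" unfolding U_def
    by (rule finite_subset[OF _ finite_PiE[of "{1..B}" "\<lambda>_. carrier G"]]) (use fin in blast)+
  have split: "{1..B} = insert 1 {2..B}" using B by auto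
  have D_sets: "D u \<in> sets M" if "u \<in> U" for u
  proof -
    have uG: "u j \<in> carrier G" if "j \<in> {1..B}" for j using \<open>u \<in> U\<close> that by (auto simp: U_def)
    have [measurable]: "S (u 1) \<in> borel_measurable M" using meas uG[of 1] B by simp
    have [measurable]: "(\<lambda>x. crit B \<alpha> (\<lambda>j. S (u j) x)) \<in> borel_measurable M"
      by (rule crit_measurable[OF \<alpha>]) (use uG meas pos in auto)
    show ?thesis unfolding D_def by measurable
  qed
  have one_U: "(\<lambda>j\<in>{1..B}. \<one>) \<in> U" using B by (auto simp: U_def)
  then have cU: "0 < card U" using finU by (auto simp: card_gt_0_iff)
  have sub: "{\<omega> \<in> space Q. S \<one> (X \<omega>) < ereal (crit B \<alpha> (\<lambda>j. S (g j \<omega>) (X \<omega>)))} = (\<Union>u\<in>U. E u)"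
  proof (intro equalityI subsetI)
    fix \<omega> assume "\<omega> \<in> {\<omega> \<in> space Q. S \<one> (X \<omega>) < ereal (crit B \<alpha> (\<lambda>j. S (g j \<omega>) (X \<omega>)))}"
    then have \<omega>: "\<omega> \<in> space Q" and less: "S \<one> (X \<omega>) < ereal (crit B \<alpha> (\<lambda>j. S (g j \<omega>) (X \<omega>)))"
      by auto
    let ?u = "\<lambda>j\<in>{1..B}. g j \<omega>"
    have u: "?u \<in> U"
      using g1[OF \<omega>] B measurable_space[OF g_meas \<omega>] unfolding U_def split by auto
    have "crit B \<alpha> (\<lambda>j. S (g j \<omega>) (X \<omega>)) = crit B \<alpha> (\<lambda>j. S (?u j) (X \<omega>))"
      by (rule crit_cong) simp
    moreover have "?u 1 = \<one>" using u by (simp add: U_def)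
    ultimately have "\<omega> \<in> E ?u"
      using \<omega> less measurable_space[OF X \<omega>] by (simp add: E_def D_def)
    with u show "\<omega> \<in> (\<Union>u\<in>U. E u)" by blast
  next
    fix \<omega> assume "\<omega> \<in> (\<Union>u\<in>U. E u)"
    then obtain u where u: "u \<in> U" "\<omega> \<in> E u" by blast
    have "crit B \<alpha> (\<lambda>j. S (g j \<omega>) (X \<omega>)) = crit B \<alpha> (\<lambda>j. S (u j) (X \<omega>))"
      by (rule crit_cong) (use u in \<open>simp add: E_def\<close>)
    then show "\<omega> \<in> {\<omega> \<in> space Q. S \<one> (X \<omega>) < ereal (crit B \<alpha> (\<lambda>j. S (g j \<omega>) (X \<omega>)))}"
      using u by (simp add: E_def D_def U_def)
  qed
  have E_sets: "E u \<in> sets Q" if "u \<in> U" for u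
  proof -
    have "E u = (X -` D u \<inter> space Q) \<inter> (\<Inter>j\<in>{2..B}. g j -` {u j} \<inter> space Q)"
      using that g1 B unfolding E_def split U_def by auto
    moreover have "X -` D u \<inter> space Q \<in> sets Q" by (rule measurable_sets[OF X D_sets[OF that]])
    moreover have "(\<Inter>j\<in>{2..B}. g j -` {u j} \<inter> space Q) \<in> sets Q"
      using that B by (intro sets.finite_INT measurable_sets[OF g_meas]) (auto simp: U_def)
    ultimately show ?thesis by simp
  qed
  have "measure Q (\<Union>u\<in>U. E u) \<le> (\<Sum>u\<in>U. measure Q (E u))"
    by (rule Q.finite_measure_subadditive_finite[OF finU]) (use E_sets in auto)
  also have "\<dots> = (\<Sum>u\<in>U. measure ?P (D u) / card U)"
    unfolding E_def U_def
    by (intro sum.cong refl random_group_elements_law[OF fin Q B X g1 g_meas g_unif g_indep g_indep_X])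
      (use D_sets in \<open>auto simp: U_def\<close>)
  also have "\<dots> = (\<Sum>u\<in>U. measure ?P (D u)) / card U" by (simp add: sum_divide_distrib)
  also have "\<dots> \<le> \<alpha> * card U / card U"
  proof (rule divide_right_mono)
    have "(\<Sum>u\<in>U. measure ?P {x \<in> space ?P. S (u 1) x < ereal (crit B \<alpha> (\<lambda>j. S (u j) x))}) \<le> \<alpha> * card U"
      unfolding U_def
      by (rule randomization_average_bound[OF grp fin _ \<alpha> _ _ _ inv])
        (use Q.prob_space_distr[OF X] B meas pos in auto)
    then show "(\<Sum>u\<in>U. measure ?P (D u)) \<le> \<alpha> * card U" by (simp add: D_def)
  qed simp
  also have "\<dots> = \<alpha>" using cU by simp
  finally show ?thesis unfolding sub .
qed

section \<open>Joint error rate and the step-down sequence\<close>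

lemma JER_ref_family:
  assumes Q: "prob_space QP" and tpl: "is_template K t" and N: "N \<subseteq> {1..m}"
    and pos: "\<And>i \<omega>. i \<in> {1..m} \<Longrightarrow> \<omega> \<in> space QP \<Longrightarrow> 0 \<le> p i (X \<omega>)"
    and Psi: "(\<lambda>\<omega>. Psi p K t (X \<omega>) N) \<in> borel_measurable QP"
    and l: "l \<in> borel_measurable QP" "\<And>\<omega>. \<omega> \<in> space QP \<Longrightarrow> l \<omega> \<in> {0..1}"
  shows "JER QP N K (ref_family m p t X l)
    = measure QP {\<omega> \<in> space QP. Psi p K t (X \<omega>) N < ereal (l \<omega>)}"
proof -
  interpret prob_space QP by (rule Q)
  let ?E = "{\<omega> \<in> space QP. Psi p K t (X \<omega>) N < ereal (l \<omega>)}"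
  have E: "?E \<in> sets QP" using Psi l(1) by measurable
  have "(\<forall>k\<in>{1..K}. card (ref_family m p t X l k \<omega> \<inter> N) \<le> k - 1)
      \<longleftrightarrow> \<not> Psi p K t (X \<omega>) N < ereal (l \<omega>)" if "\<omega> \<in> space QP" for \<omega>
  proof -
    have "ref_family m p t X l k \<omega> \<inter> N = {i \<in> N. p i (X \<omega>) < t k (l \<omega>)}" for k
      using N by (auto simp: ref_family_def)
    moreover have "Psi p K t (X \<omega>) N < ereal (l \<omega>)
        \<longleftrightarrow> (\<exists>k\<in>{1..K}. k \<le> card {i \<in> N. p i (X \<omega>) < t k (l \<omega>)})"
      by (rule Psi_less_iff[OF tpl])
        (use N pos l(2) that finite_subset[OF N] in \<open>auto simp del: atLeastAtMost_iff\<close>)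
    moreover have "c \<le> k - 1 \<longleftrightarrow> \<not> k \<le> c" if "k \<in> {1..K}" for k c :: nat
      using that by auto
    ultimately show ?thesis by (simp only:) blast
  qed
  then have "{\<omega> \<in> space QP. \<forall>k\<in>{1..K}. card (ref_family m p t X l k \<omega> \<inter> N) \<le> k - 1}
      = space QP - ?E" by blast
  then show ?thesis unfolding JER_def using prob_compl[OF E] by simp
qed

text \<open>Measurability of the random set is needed because the JER is defined through
  \<open>measure\<close>, which is \<open>0\<close> on non-measurable events.\<close>
lemma step_down_measurable:
  assumes meas: "\<And>i A. i \<in> {1..m} \<Longrightarrow> A \<subseteq> {1..m} \<Longrightarrow>
      {\<omega> \<in> space W. t 1 (lam \<alpha> A \<omega>) \<le> p i (X \<omega>)} \<in> sets W"
  shows "step_down m p t X lam \<alpha> \<in> W \<rightarrow>\<^sub>M count_space (Pow {1..m})"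
proof -
  let ?I = "Pow {1..m}" and ?A = "step_down_seq m p t X lam \<alpha>"
  have step: "(\<lambda>\<omega>. {i \<in> {1..m}. p i (X \<omega>) \<ge> t 1 (lam \<alpha> A \<omega>)}) \<in> W \<rightarrow>\<^sub>M count_space ?I"
    if A: "A \<in> ?I" for A
    unfolding measurable_count_space_eq2[OF finite_Pow_iff[THEN iffD2, OF finite_atLeastAtMost]]
  proof safe
    fix a assume a: "a \<subseteq> {1..m}"
    let ?V = "\<lambda>i. {\<omega> \<in> space W. t 1 (lam \<alpha> A \<omega>) \<le> p i (X \<omega>)}"
    have "(\<lambda>\<omega>. {i \<in> {1..m}. p i (X \<omega>) \<ge> t 1 (lam \<alpha> A \<omega>)}) -` {a} \<inter> space W
        = {\<omega> \<in> space W. \<forall>i\<in>{1..m}. \<omega> \<in> (if i \<in> a then ?V i else space W - ?V i)}"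
    proof (rule Set.set_eqI)
      fix \<omega>
      have "{i \<in> {1..m}. p i (X \<omega>) \<ge> t 1 (lam \<alpha> A \<omega>)} = a
          \<longleftrightarrow> (\<forall>i\<in>{1..m}. i \<in> a \<longleftrightarrow> t 1 (lam \<alpha> A \<omega>) \<le> p i (X \<omega>))"
        using a by blast
      then show "\<omega> \<in> (\<lambda>\<omega>. {i \<in> {1..m}. p i (X \<omega>) \<ge> t 1 (lam \<alpha> A \<omega>)}) -` {a} \<inter> space W \<longleftrightarrow>
          \<omega> \<in> {\<omega> \<in> space W. \<forall>i\<in>{1..m}. \<omega> \<in> (if i \<in> a then ?V i else space W - ?V i)}"
        by (simp del: atLeastAtMost_iff) blast
    qed
    also have "\<dots> \<in> sets W"
    proof (rule sets.sets_Collect_finite_All)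
      fix i assume "i \<in> {1..m}"
      then have "(if i \<in> a then ?V i else space W - ?V i) \<in> sets W"
        using meas[of i A] A by auto
      moreover from this have "{\<omega> \<in> space W. \<omega> \<in> (if i \<in> a then ?V i else space W - ?V i)}
          = (if i \<in> a then ?V i else space W - ?V i)" by auto
      ultimately show "{\<omega> \<in> space W. \<omega> \<in> (if i \<in> a then ?V i else space W - ?V i)} \<in> sets W"
        by (simp only:)
    qed simp
    finally show "(\<lambda>\<omega>. {i \<in> {1..m}. p i (X \<omega>) \<ge> t 1 (lam \<alpha> A \<omega>)}) -` {a} \<inter> space W \<in> sets W" .
  qed
  have seq: "(\<lambda>\<omega>. ?A \<omega> j) \<in> W \<rightarrow>\<^sub>M count_space ?I" for j
  proof (induction j)
    case 0
    then show ?case by simp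
  next
    case (Suc j)
    show ?case unfolding step_down_seq.simps
      by (rule measurable_compose_countable'[OF step Suc]) (simp_all add: countable_finite)
  qed
  have "(\<lambda>\<omega>. j \<ge> 1 \<and> ?A \<omega> j = ?A \<omega> (j - 1)) \<in> W \<rightarrow>\<^sub>M count_space UNIV" for j
  proof -
    have "{\<omega> \<in> space W. ?A \<omega> j = ?A \<omega> (j - 1)}
        = (\<Union>a\<in>?I. ((\<lambda>\<omega>. ?A \<omega> j) -` {a} \<inter> space W) \<inter> ((\<lambda>\<omega>. ?A \<omega> (j - 1)) -` {a} \<inter> space W))"
      using measurable_space[OF seq[of j]] by auto
    also have "\<dots> \<in> sets W"
      by (intro sets.finite_UN sets.Int measurable_sets[OF seq]) auto
    finally have [measurable]: "Measurable.pred W (\<lambda>\<omega>. ?A \<omega> j = ?A \<omega> (j - 1))"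
      by (simp add: pred_def)
    show ?thesis by measurable
  qed
  then have "(\<lambda>\<omega>. LEAST j. j \<ge> 1 \<and> ?A \<omega> j = ?A \<omega> (j - 1)) \<in> W \<rightarrow>\<^sub>M count_space UNIV"
    by (rule measurable_Least)
  from measurable_compose_countable[OF seq this]
  show ?thesis unfolding step_down_def Let_def .
qed

text \<open>Every member of the sequence contains \<open>N\<close>, so nothing about the stopping index is used.\<close>
lemma step_down_superset:
  assumes "N \<subseteq> {1..m}"
    and "\<And>A. N \<subseteq> A \<Longrightarrow> A \<subseteq> {1..m} \<Longrightarrow> \<forall>i\<in>N. t 1 (lam \<alpha> A \<omega>) \<le> p i (X \<omega>)"
  shows "N \<subseteq> step_down m p t X lam \<alpha> \<omega>" "step_down m p t X lam \<alpha> \<omega> \<subseteq> {1..m}"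
proof -
  have "N \<subseteq> step_down_seq m p t X lam \<alpha> \<omega> j \<and> step_down_seq m p t X lam \<alpha> \<omega> j \<subseteq> {1..m}" for j
  proof (induction j)
    case 0
    then show ?case using assms(1) by simp
  next
    case (Suc j)
    then show ?case using assms(2)[of "step_down_seq m p t X lam \<alpha> \<omega> j"] assms(1)
      by (auto simp del: atLeastAtMost_iff)
  qed
  then show "N \<subseteq> step_down m p t X lam \<alpha> \<omega>" "step_down m p t X lam \<alpha> \<omega> \<subseteq> {1..m}"
    by (auto simp: step_down_def Let_def)
qed

section \<open>Calibration and error control\<close>

theorem theorem5p8:
  fixes M :: "'x measure"
    and \<P> :: "'x measure set"
    and H :: "nat \<Rightarrow> 'x measure set"
    and p :: "nat \<Rightarrow> 'x \<Rightarrow> real"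
    and t :: "nat \<Rightarrow> real \<Rightarrow> real"
    and m K B :: nat
    and G :: "('g, 'r) monoid_scheme"
    and act :: "'g \<Rightarrow> 'x \<Rightarrow> 'x"
    and W :: "'w measure"
    and Q :: "'x measure \<Rightarrow> 'w measure"
    and X :: "'w \<Rightarrow> 'x"
    and g :: "nat \<Rightarrow> 'w \<Rightarrow> 'g"
  defines "lam \<equiv> rand_lambda act B g p K t X"
  assumes model: "\<And>P. P \<in> \<P> \<Longrightarrow> prob_space P \<and> sets P = sets M"
    and nulls: "\<And>i. i \<in> {1..m} \<Longrightarrow> H i \<subseteq> \<P>"
    and pval_range: "\<And>i x. i \<in> {1..m} \<Longrightarrow> x \<in> space M \<Longrightarrow> p i x \<in> {0..1}"
    and K: "K \<in> {1..m}"
    and template: "is_template K t"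
    and action: "group_action G (space M) act"
    and finite_G: "finite (carrier G)"
    and pval_meas: "\<And>i h. i \<in> {1..m} \<Longrightarrow> h \<in> carrier G \<Longrightarrow>
          (\<lambda>x. p i (act h x)) \<in> borel_measurable M"
    and invariance: "\<And>P h. P \<in> \<P> \<Longrightarrow> h \<in> carrier G \<Longrightarrow>
          distr P (Pi\<^sub>M (carrier G) (\<lambda>_. Pi\<^sub>M (true_nulls H m P) (\<lambda>_. borel)))
            (\<lambda>x. \<lambda>h'\<in>carrier G. \<lambda>i\<in>true_nulls H m P. p i (act h' x))
        = distr P (Pi\<^sub>M (carrier G) (\<lambda>_. Pi\<^sub>M (true_nulls H m P) (\<lambda>_. borel)))
            (\<lambda>x. \<lambda>h'\<in>carrier G. \<lambda>i\<in>true_nulls H m P. p i (act h' (act h x)))"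
    and B: "B \<ge> 2"
    and prob: "\<And>P. P \<in> \<P> \<Longrightarrow> prob_space (Q P) \<and> sets (Q P) = sets W"
    and X_meas: "X \<in> W \<rightarrow>\<^sub>M M"
    and X_law: "\<And>P. P \<in> \<P> \<Longrightarrow> distr (Q P) M X = P"
    and g1: "\<And>\<omega>. \<omega> \<in> space W \<Longrightarrow> g 1 \<omega> = \<one>\<^bsub>G\<^esub>"
    and g_meas: "\<And>j. j \<in> {2..B} \<Longrightarrow> g j \<in> W \<rightarrow>\<^sub>M count_space (carrier G)"
    and g_unif: "\<And>P j. P \<in> \<P> \<Longrightarrow> j \<in> {2..B} \<Longrightarrow>
          distr (Q P) (count_space (carrier G)) (g j) = uniform_count_measure (carrier G)"
    and g_indep: "\<And>P. P \<in> \<P> \<Longrightarrow>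
          prob_space.indep_vars (Q P) (\<lambda>_. count_space (carrier G)) g {2..B}"
    and g_indep_X: "\<And>P. P \<in> \<P> \<Longrightarrow>
          prob_space.indep_set (Q P) (sets (vimage_algebra (space W) X M))
            (sets (vimage_algebra (space W) (\<lambda>\<omega>. \<lambda>j\<in>{2..B}. g j \<omega>)
               (Pi\<^sub>M {2..B} (\<lambda>_. count_space (carrier G)))))"
  shows "is_lambda_calibration W Q \<P> H m p K t X lam \<and>
    (\<forall>\<alpha>\<in>{0<..<1}. \<forall>P\<in>\<P>.
       JER (Q P) (true_nulls H m P) K (ref_family m p t X (lam \<alpha> {1..m})) \<le> \<alpha> \<and>
       JER (Q P) (true_nulls H m P) K
         (ref_family m p t X (\<lambda>\<omega>. lam \<alpha> (step_down m p t X lam \<alpha> \<omega>) \<omega>)) \<le> \<alpha>)"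
proof -
  interpret action: group_action G "space M" act by (rule action)
  have grp: "group G" using action.group_hom by (rule group_hom.axioms(1))
  interpret group G by (rule grp)
  let ?N = "true_nulls H m"
  let ?\<Psi> = "\<lambda>j \<omega> A. Psi p K t (act (g j \<omega>) (X \<omega>)) A"
  have N: "?N P \<subseteq> {1..m}" for P by (auto simp: true_nulls_def)
  have fin: "finite A" if "A \<subseteq> {1..m}" for A :: "nat set" using that finite_subset by blast
  have act_in: "act h x \<in> space M" if "h \<in> carrier G" "x \<in> space M" for h x
    using action.element_image[OF that refl] .
  have act_one: "act \<one>\<^bsub>G\<^esub> x = x" if "x \<in> space M" for x
    using action.id_eq_one that by (metis restrict_apply')
  have p_pos: "0 \<le> p i x" if "i \<in> {1..m}" "x \<in> space M" for i x
    using pval_range[OF that] by simp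
  have Xin: "X \<omega> \<in> space M" if "\<omega> \<in> space W" for \<omega> using measurable_space[OF X_meas that] .
  have split: "{1..B} = insert 1 {2..B}" using B by auto
  have g_in: "g j \<omega> \<in> carrier G" if "j \<in> {1..B}" "\<omega> \<in> space W" for j \<omega>
    using that measurable_space[OF g_meas, of j \<omega>] g1 unfolding split by auto
  have Psi_pos: "0 \<le> Psi p K t x A" if "A \<subseteq> {1..m}" "x \<in> space M" for A x
    by (rule Psi_nonneg[OF template fin]) (use that p_pos in auto)
  have Psi_act_meas: "(\<lambda>x. Psi p K t (act h x) A) \<in> borel_measurable M"
    if "A \<subseteq> {1..m}" "h \<in> carrier G" for A h
  proof -
    have "(\<lambda>x. Psi (\<lambda>i x. p i (act h x)) K t x A) \<in> borel_measurable M"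
      by (rule Psi_measurable[OF template fin]) (use that pval_meas p_pos act_in in auto)
    then show ?thesis by (simp add: Psi_def)
  qed
  have Psi_meas: "(\<lambda>\<omega>. Psi p K t (X \<omega>) A) \<in> borel_measurable W" if "A \<subseteq> {1..m}" for A
  proof -
    have "(\<lambda>\<omega>. Psi p K t (act \<one>\<^bsub>G\<^esub> (X \<omega>)) A) \<in> borel_measurable W"
      using measurable_compose[OF X_meas Psi_act_meas[OF that one_closed]] .
    moreover have "(\<lambda>\<omega>. Psi p K t (act \<one>\<^bsub>G\<^esub> (X \<omega>)) A) \<in> borel_measurable W
        \<longleftrightarrow> (\<lambda>\<omega>. Psi p K t (X \<omega>) A) \<in> borel_measurable W"
      by (rule measurable_cong) (simp add: act_one Xin)
    ultimately show ?thesis by blast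
  qed
  have Psi_g_meas: "(\<lambda>\<omega>. ?\<Psi> j \<omega> A) \<in> borel_measurable W" if "A \<subseteq> {1..m}" "j \<in> {1..B}" for A j
  proof (cases "j = 1")
    case True
    have "(\<lambda>\<omega>. ?\<Psi> j \<omega> A) \<in> borel_measurable W \<longleftrightarrow> (\<lambda>\<omega>. Psi p K t (X \<omega>) A) \<in> borel_measurable W"
      by (rule measurable_cong) (simp only: True g1 act_one Xin)
    then show ?thesis using Psi_meas[OF that(1)] by simp
  next
    case False
    then have "j \<in> {2..B}" using that by auto
    show ?thesis
      by (rule measurable_compose_countable'[of "carrier G" "\<lambda>h \<omega>. Psi p K t (act h (X \<omega>)) A",
            OF measurable_compose[OF X_meas Psi_act_meas[OF that(1)]] g_meas[OF \<open>j \<in> {2..B}\<close>]])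
        (use finite_G in \<open>auto intro: countable_finite\<close>)
  qed
  have Psi_g_pos: "0 \<le> ?\<Psi> j \<omega> A" if "A \<subseteq> {1..m}" "j \<in> {1..B}" "\<omega> \<in> space W" for A j \<omega>
    using Psi_pos[OF that(1)] act_in[OF g_in[OF that(2,3)]] Xin[OF that(3)] by blast
  have lam_crit: "lam \<alpha> A \<omega> = crit B \<alpha> (\<lambda>j. ?\<Psi> j \<omega> A)" for \<alpha> A \<omega>
    by (simp add: lam_def rand_lambda_def crit_def)
  have lam_meas: "lam \<alpha> A \<in> borel_measurable W" if "0 \<le> \<alpha>" "A \<subseteq> {1..m}" for \<alpha> A
  proof -
    have "(\<lambda>\<omega>. crit B \<alpha> (\<lambda>j. ?\<Psi> j \<omega> A)) \<in> borel_measurable W"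
      by (rule crit_measurable[OF that(1)]) (use Psi_g_meas Psi_g_pos that in auto)
    then show ?thesis by (simp add: lam_crit[abs_def])
  qed
  have lam_01: "lam \<alpha> A \<omega> \<in> {0..1}" if "0 \<le> \<alpha>" "A \<subseteq> {1..m}" "\<omega> \<in> space W" for \<alpha> A \<omega>
    unfolding lam_crit by (rule crit_props(1)) (use Psi_g_pos that in auto)
  have lam_anti: "lam \<alpha> A' \<omega> \<le> lam \<alpha> A \<omega>"
    if "0 \<le> \<alpha>" "A \<subseteq> A'" "A' \<subseteq> {1..m}" "\<omega> \<in> space W" for \<alpha> A A' \<omega>
    unfolding lam_crit
  proof (rule crit_mono)
    fix j l assume j: "j \<in> {1..B}" and l: "l \<in> {0..1}" and less: "?\<Psi> j \<omega> A < ereal l"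
    show "?\<Psi> j \<omega> A' < ereal l"
      by (rule Psi_less_antimono[OF template that(2) fin[OF that(3)] _ l less])
        (use p_pos act_in g_in[OF j] Xin that in blast)
  qed (use that Psi_g_pos in auto)
  \<comment> \<open>The calibration inequality. The map \<open>?F\<close> pushes the invariance of the \<open>p\<close>-values forward to the
    statistics. The truncation \<open>max 0\<close> leaves \<open>p\<close>-values unchanged; without it \<open>?T\<close> would take the
    generalised inverse at negative values, where it is the maximum of an empty set.\<close>
  have level: "measure (Q P) {\<omega> \<in> space (Q P). Psi p K t (X \<omega>) (?N P) < ereal (lam \<alpha> (?N P) \<omega>)} \<le> \<alpha>"
    if P: "P \<in> \<P>" and \<alpha>: "0 \<le> \<alpha>" for P \<alpha>
  proof -
    have Q: "prob_space (Q P)" and setsQ: "sets (Q P) = sets W" using prob[OF P] by auto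
    have spaceQ: "space (Q P) = space W" by (rule sets_eq_imp_space_eq[OF setsQ])
    have setsP: "sets P = sets M" using model[OF P] by simp
    have spaceP: "space P = space M" by (rule sets_eq_imp_space_eq[OF setsP])
    let ?S = "\<lambda>h x. Psi p K t (act h x) (?N P)"
    let ?PN = "Pi\<^sub>M (?N P) (\<lambda>_. borel) :: (nat \<Rightarrow> real) measure"
    let ?PG = "Pi\<^sub>M (carrier G) (\<lambda>_. ?PN)"
    let ?T = "\<lambda>z. Psi (\<lambda>i z. max 0 (z i)) K t z (?N P)"
    let ?F = "\<lambda>y. \<lambda>h'\<in>carrier G. ?T (y h')"
    have T: "?T \<in> borel_measurable ?PN"
      by (rule Psi_measurable[OF template fin[OF N]]) auto
    have F: "?F \<in> ?PG \<rightarrow>\<^sub>M Pi\<^sub>M (carrier G) (\<lambda>_. borel)"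
    proof (rule measurable_restrict)
      fix h' assume "h' \<in> carrier G"
      then have "(\<lambda>y. y h') \<in> ?PG \<rightarrow>\<^sub>M ?PN" by (rule measurable_component_singleton)
      then show "(\<lambda>y. ?T (y h')) \<in> borel_measurable ?PG" by (rule measurable_compose[OF _ T])
    qed
    have push: "distr (distr P ?PG (\<lambda>x. \<lambda>h'\<in>carrier G. \<lambda>i\<in>?N P. p i (act (f h') x)))
          (Pi\<^sub>M (carrier G) (\<lambda>_. borel)) ?F
        = distr P (Pi\<^sub>M (carrier G) (\<lambda>_. borel)) (\<lambda>x. \<lambda>h'\<in>carrier G. ?S (f h') x)"
      if f: "f \<in> carrier G \<rightarrow> carrier G" for f
    proof -
      have "(\<lambda>x. p i (act (f h') x)) \<in> borel_measurable P" if "i \<in> ?N P" "h' \<in> carrier G" for i h'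
        using pval_meas[of i "f h'"] f N that measurable_cong_sets[OF setsP refl] by blast
      then have m: "(\<lambda>x. \<lambda>h'\<in>carrier G. \<lambda>i\<in>?N P. p i (act (f h') x)) \<in> P \<rightarrow>\<^sub>M ?PG"
        by (intro measurable_restrict)
      have "?T (\<lambda>i\<in>?N P. p i (act h x)) = ?S h x" if "h \<in> carrier G" "x \<in> space M" for h x
        by (rule Psi_cong[OF fin[OF N]]) (use N p_pos act_in that in \<open>auto simp: max_def subset_iff\<close>)
      then show ?thesis
        unfolding distr_distr[OF F m]
        by (intro distr_cong) (use f spaceP in \<open>auto simp: restrict_def fun_eq_iff\<close>)
    qed
    have inv: "distr P (Pi\<^sub>M (carrier G) (\<lambda>_. borel)) (\<lambda>x. \<lambda>h'\<in>carrier G. ?S h' x)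
        = distr P (Pi\<^sub>M (carrier G) (\<lambda>_. borel)) (\<lambda>x. \<lambda>h'\<in>carrier G. ?S (h' \<otimes>\<^bsub>G\<^esub> h) x)"
      if h: "h \<in> carrier G" for h
    proof -
      have "distr P ?PG (\<lambda>x. \<lambda>h'\<in>carrier G. \<lambda>i\<in>?N P. p i (act h' (act h x)))
          = distr P ?PG (\<lambda>x. \<lambda>h'\<in>carrier G. \<lambda>i\<in>?N P. p i (act (h' \<otimes>\<^bsub>G\<^esub> h) x))"
        by (intro distr_cong refl)
          (use h spaceP action.composition_rule in \<open>auto simp: restrict_def fun_eq_iff\<close>)
      then have "distr P ?PG (\<lambda>x. \<lambda>h'\<in>carrier G. \<lambda>i\<in>?N P. p i (act h' x))
          = distr P ?PG (\<lambda>x. \<lambda>h'\<in>carrier G. \<lambda>i\<in>?N P. p i (act (h' \<otimes>\<^bsub>G\<^esub> h) x))"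
        using invariance[OF P h] by simp
      then show ?thesis
        using push[of "\<lambda>h'. h'"] push[of "\<lambda>h'. h' \<otimes>\<^bsub>G\<^esub> h"] h by simp
    qed
    have "measure (Q P) {\<omega> \<in> space (Q P).
        ?S \<one>\<^bsub>G\<^esub> (X \<omega>) < ereal (crit B \<alpha> (\<lambda>j. ?S (g j \<omega>) (X \<omega>)))} \<le> \<alpha>"
    proof (rule randomization_level[where S = ?S, OF grp finite_G Q B \<alpha>])
      show "X \<in> Q P \<rightarrow>\<^sub>M M" using X_meas measurable_cong_sets[OF setsQ refl] by blast
      show "g j \<in> Q P \<rightarrow>\<^sub>M count_space (carrier G)" if "j \<in> {2..B}" for j
        using g_meas[OF that] measurable_cong_sets[OF setsQ refl] by blast
      show "prob_space.indep_set (Q P) (sets (vimage_algebra (space (Q P)) X M))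
          (sets (vimage_algebra (space (Q P)) (\<lambda>\<omega>. \<lambda>j\<in>{2..B}. g j \<omega>)
             (Pi\<^sub>M {2..B} (\<lambda>_. count_space (carrier G)))))"
        unfolding spaceQ by (rule g_indep_X[OF P])
    qed (use g1 spaceQ g_unif[OF P] g_indep[OF P] Psi_act_meas[OF N] Psi_pos[OF N] act_in
        X_law[OF P] inv in auto)
    moreover have "{\<omega> \<in> space (Q P). ?S \<one>\<^bsub>G\<^esub> (X \<omega>) < ereal (crit B \<alpha> (\<lambda>j. ?S (g j \<omega>) (X \<omega>)))}
        = {\<omega> \<in> space (Q P). Psi p K t (X \<omega>) (?N P) < ereal (lam \<alpha> (?N P) \<omega>)}"
      using act_one Xin spaceQ by (auto simp: lam_crit)
    ultimately show ?thesis by simp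
  qed
  \<comment> \<open>The event \<open>Psi (X) N < l\<close> is contained in \<open>Psi (X) N < \<lambda>(\<alpha>, N)\<close> as soon as \<open>l \<le> \<lambda>(\<alpha>, N)\<close>
    holds off the latter.\<close>
  have JER_le: "JER (Q P) (?N P) K (ref_family m p t X l) \<le> \<alpha>"
    if P: "P \<in> \<P>" and \<alpha>: "0 \<le> \<alpha>" and l: "l \<in> borel_measurable W" "\<And>\<omega>. \<omega> \<in> space W \<Longrightarrow> l \<omega> \<in> {0..1}"
      and le: "\<And>\<omega>. \<omega> \<in> space W \<Longrightarrow> \<not> Psi p K t (X \<omega>) (?N P) < ereal (lam \<alpha> (?N P) \<omega>)
        \<Longrightarrow> l \<omega> \<le> lam \<alpha> (?N P) \<omega>" for P \<alpha> l
  proof -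
    have Q: "prob_space (Q P)" and setsQ: "sets (Q P) = sets W" using prob[OF P] by auto
    interpret Q: prob_space "Q P" by (rule Q)
    have spaceQ: "space (Q P) = space W" by (rule sets_eq_imp_space_eq[OF setsQ])
    note measQ = measurable_cong_sets[OF setsQ refl]
    have [measurable]: "(\<lambda>\<omega>. Psi p K t (X \<omega>) (?N P)) \<in> borel_measurable (Q P)"
      "lam \<alpha> (?N P) \<in> borel_measurable (Q P)"
      using Psi_meas[OF N] lam_meas[OF \<alpha> N] measQ by blast+
    have lQ: "l \<in> borel_measurable (Q P)" using l(1) measQ by blast
    have "JER (Q P) (?N P) K (ref_family m p t X l)
        = measure (Q P) {\<omega> \<in> space (Q P). Psi p K t (X \<omega>) (?N P) < ereal (l \<omega>)}"
      by (rule JER_ref_family[OF Q template N])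
        (use p_pos Xin spaceQ lQ l(2) in \<open>simp_all del: atLeastAtMost_iff\<close>)
    also have "\<dots> \<le> measure (Q P) {\<omega> \<in> space (Q P). Psi p K t (X \<omega>) (?N P) < ereal (lam \<alpha> (?N P) \<omega>)}"
    proof (rule Q.finite_measure_mono)
      show "{\<omega> \<in> space (Q P). Psi p K t (X \<omega>) (?N P) < ereal (l \<omega>)}
          \<subseteq> {\<omega> \<in> space (Q P). Psi p K t (X \<omega>) (?N P) < ereal (lam \<alpha> (?N P) \<omega>)}"
      proof safe
        fix \<omega> assume \<omega>: "\<omega> \<in> space (Q P)" and less: "Psi p K t (X \<omega>) (?N P) < ereal (l \<omega>)"
        show "Psi p K t (X \<omega>) (?N P) < ereal (lam \<alpha> (?N P) \<omega>)"
        proof (rule ccontr)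
          assume no: "\<not> ?thesis"
          then have "ereal (l \<omega>) \<le> ereal (lam \<alpha> (?N P) \<omega>)" using le \<omega> spaceQ by simp
          with less no show False using less_le_trans by blast
        qed
      qed
    qed measurable
    also have "\<dots> \<le> \<alpha>" by (rule level[OF P \<alpha>])
    finally show ?thesis .
  qed
  have K1: "1 \<in> {1..K}" using K by auto
  \<comment> \<open>The selection rule of the step-down algorithm is a statement about \<open>Psi\<close> on a singleton, so
    measurability and monotonicity of \<open>Psi\<close> apply to it.\<close>
  have single: "t 1 l \<le> p i x \<longleftrightarrow> \<not> Psi p K t x {i} < ereal l"
    if "i \<in> {1..m}" "x \<in> space M" "l \<in> {0..1}" for i x l
  proof -
    have "Psi p K t x {i} < ereal l \<longleftrightarrow> (\<exists>k\<in>{1..K}. k \<le> card {i' \<in> {i}. p i' x < t k l})"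
      by (rule Psi_less_iff[OF template]) (use p_pos that in auto)
    also have "\<dots> \<longleftrightarrow> p i x < t 1 l"
    proof
      assume "\<exists>k\<in>{1..K}. k \<le> card {i' \<in> {i}. p i' x < t k l}"
      then obtain k where k: "k \<in> {1..K}" "k \<le> card {i' \<in> {i}. p i' x < t k l}" by blast
      moreover have "card {i' \<in> {i}. p i' x < t k l} \<le> card {i}" by (rule card_mono) auto
      ultimately have "k = 1" by simp
      with k(2) have "{i' \<in> {i}. p i' x < t 1 l} \<noteq> {}" by (metis card.empty not_one_le_zero)
      then show "p i x < t 1 l" by auto
    next
      assume "p i x < t 1 l"
      then have "{i' \<in> {i}. p i' x < t 1 l} = {i}" by auto
      then have "1 \<le> card {i' \<in> {i}. p i' x < t 1 l}" by simp
      then show "\<exists>k\<in>{1..K}. k \<le> card {i' \<in> {i}. p i' x < t k l}" using K1 by blast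
    qed
    finally show ?thesis by auto
  qed
  have sd_meas: "step_down m p t X lam \<alpha> \<in> W \<rightarrow>\<^sub>M count_space (Pow {1..m})" if \<alpha>: "0 \<le> \<alpha>" for \<alpha>
  proof (rule step_down_measurable)
    fix i A assume i: "i \<in> {1..m}" and A: "A \<subseteq> {1..m}"
    have [measurable]: "(\<lambda>\<omega>. Psi p K t (X \<omega>) {i}) \<in> borel_measurable W" "lam \<alpha> A \<in> borel_measurable W"
      using Psi_meas[of "{i}"] lam_meas[OF \<alpha> A] i by auto
    have "{\<omega> \<in> space W. t 1 (lam \<alpha> A \<omega>) \<le> p i (X \<omega>)}
        = {\<omega> \<in> space W. \<not> Psi p K t (X \<omega>) {i} < ereal (lam \<alpha> A \<omega>)}"
      using single[OF i Xin lam_01[OF \<alpha> A]] by blast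
    also have "\<dots> \<in> sets W" by measurable
    finally show "{\<omega> \<in> space W. t 1 (lam \<alpha> A \<omega>) \<le> p i (X \<omega>)} \<in> sets W" .
  qed
  have sd_sub: "step_down m p t X lam \<alpha> \<omega> \<subseteq> {1..m}" for \<alpha> \<omega>
    by (rule step_down_superset(2)[of "{}"]) auto
  have sd_sup: "?N P \<subseteq> step_down m p t X lam \<alpha> \<omega>"
    if \<alpha>: "0 \<le> \<alpha>" and \<omega>: "\<omega> \<in> space W"
      and no: "\<not> Psi p K t (X \<omega>) (?N P) < ereal (lam \<alpha> (?N P) \<omega>)" for P \<alpha> \<omega>
  proof (rule step_down_superset(1)[OF N], rule ballI)
    fix A i assume A: "?N P \<subseteq> A" "A \<subseteq> {1..m}" and i: "i \<in> ?N P"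
    have im: "i \<in> {1..m}" using i N by blast
    show "t 1 (lam \<alpha> A \<omega>) \<le> p i (X \<omega>)"
    proof (subst single[OF im Xin[OF \<omega>] lam_01[OF \<alpha> A(2) \<omega>]], rule notI)
      assume "Psi p K t (X \<omega>) {i} < ereal (lam \<alpha> A \<omega>)"
      then have "Psi p K t (X \<omega>) (?N P) < ereal (lam \<alpha> A \<omega>)"
      proof (rule Psi_less_antimono[OF template _ fin[OF N] _ lam_01[OF \<alpha> A(2) \<omega>], rotated 2])
        show "{i} \<subseteq> ?N P" using i by simp
        show "0 \<le> p i' (X \<omega>)" if "i' \<in> ?N P" for i'
          using p_pos[OF _ Xin[OF \<omega>]] N[of P] that by blast
      qed
      also have "\<dots> \<le> ereal (lam \<alpha> (?N P) \<omega>)" using lam_anti[OF \<alpha> A \<omega>] by simp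
      finally show False using no by blast
    qed
  qed
  have sd_lam_meas: "(\<lambda>\<omega>. lam \<alpha> (step_down m p t X lam \<alpha> \<omega>) \<omega>) \<in> borel_measurable W"
    if "0 \<le> \<alpha>" for \<alpha>
  proof (rule measurable_compose_countable'[OF lam_meas[OF that] sd_meas[OF that]])
    show "countable (Pow {1..m})" by (rule countable_finite) simp
  qed simp
  have "is_lambda_calibration W Q \<P> H m p K t X lam"
    unfolding is_lambda_calibration_def
  proof (intro conjI ballI allI impI)
    fix \<alpha> :: real and A assume \<alpha>: "\<alpha> \<in> {0<..<1}" and A: "A \<subseteq> {1..m}"
    show "lam \<alpha> A \<in> borel_measurable W" by (rule lam_meas) (use \<alpha> A in simp_all)
    show "lam \<alpha> A \<omega> \<in> {0..1}" if "\<omega> \<in> space W" for \<omega>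
      by (rule lam_01) (use \<alpha> A that in simp_all)
  next
    fix \<alpha> :: real and A A' \<omega>
    assume \<alpha>: "\<alpha> \<in> {0<..<1}" and A: "A \<subseteq> A' \<and> A' \<subseteq> {1..m}" and \<omega>: "\<omega> \<in> space W"
    show "lam \<alpha> A' \<omega> \<le> lam \<alpha> A \<omega>" by (rule lam_anti) (use \<alpha> A \<omega> in simp_all)
  next
    fix \<alpha> :: real and P assume \<alpha>: "\<alpha> \<in> {0<..<1}" and P: "P \<in> \<P>"
    show "measure (Q P) {\<omega> \<in> space (Q P). Psi p K t (X \<omega>) (?N P) < ereal (lam \<alpha> (?N P) \<omega>)} \<le> \<alpha>"
      by (rule level[OF P]) (use \<alpha> in simp)
  qed
  moreover have "JER (Q P) (?N P) K (ref_family m p t X (lam \<alpha> {1..m})) \<le> \<alpha>"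
    if P: "P \<in> \<P>" and \<alpha>: "0 \<le> \<alpha>" for P \<alpha>
  proof (rule JER_le[OF P \<alpha> lam_meas[OF \<alpha> order_refl]])
    fix \<omega> assume \<omega>: "\<omega> \<in> space W"
    show "lam \<alpha> {1..m} \<omega> \<in> {0..1}" by (rule lam_01[OF \<alpha> order_refl \<omega>])
    show "lam \<alpha> {1..m} \<omega> \<le> lam \<alpha> (?N P) \<omega>" by (rule lam_anti[OF \<alpha> N order_refl \<omega>])
  qed
  moreover have "JER (Q P) (?N P) K
      (ref_family m p t X (\<lambda>\<omega>. lam \<alpha> (step_down m p t X lam \<alpha> \<omega>) \<omega>)) \<le> \<alpha>"
    if P: "P \<in> \<P>" and \<alpha>: "0 \<le> \<alpha>" for P \<alpha>
  proof (rule JER_le[OF P \<alpha> sd_lam_meas[OF \<alpha>]])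
    fix \<omega> assume \<omega>: "\<omega> \<in> space W"
    show "lam \<alpha> (step_down m p t X lam \<alpha> \<omega>) \<omega> \<in> {0..1}" by (rule lam_01[OF \<alpha> sd_sub \<omega>])
    show "lam \<alpha> (step_down m p t X lam \<alpha> \<omega>) \<omega> \<le> lam \<alpha> (?N P) \<omega>"
      if "\<not> Psi p K t (X \<omega>) (?N P) < ereal (lam \<alpha> (?N P) \<omega>)"
      by (rule lam_anti[OF \<alpha> sd_sup[OF \<alpha> \<omega> that] sd_sub \<omega>])
  qed
  ultimately show ?thesis by simp
qed

end
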